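(* Let $q\ge2$ and let $T$ be an ordered five-element real alphabet whose complete space of vanishing $q$-relations has rank one, with primitive balanced generator $\delta$ of mass $\mu$. Then $2\le\mu\le q$, and $T$ has a primitive order-preserving integer $q$-model of diameter at most $\mu q(q+1)$.
   Context: An ordered real $m$-alphabet is a strictly increasing tuple $T=(t_0<\cdots<t_{m-1})$ of reals (here $m=5$). A balanced vector is $\delta\in\mathbb{Z}^m$ with $\sum_i\delta_i=0$; its mass is $\sum_i\max(\delta_i,0)$. A $q$-relation is a balanced vector of mass at most $q$; it vanishes on $T$ if $\delta\cdot T:=\sum_i\delta_it_i=0$. The complete space of vanishing $q$-relations is the rational span of all $q$-relations vanishing on $T$, and its rank is its dimension. When the rank is one, its primitive balanced generator is the integer vector with coprime entries (unique up to sign) spanning it. An order-preserving integer $q$-model of $T$ is a strictly increasing integer tuple $T'=(t'_0<\cdots<t'_{m-1})$ such that for every balanced $\delta$ of mass at most $q$, $\delta\cdot T=0$ if and only if $\delta\cdot T'=0$. Its diameter is $t'_{m-1}-t'_0$; it is primitive if, after translating its first letter to $0$, the gcd of its letters is $1$. *)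

theory Defs
  imports "HOL-Analysis.Analysis"
begin

text \<open>
  An \<open>m\<close>-tuple is a vector over a finite linearly ordered index type \<open>'m\<close>. For the numeral
  type \<open>5\<close> the indices are \<open>0 < 1 < 2 < 3 < 4\<close>, in the order inherited from the integers.
\<close>

definition ordered_alphabet :: "'a::linorder ^ 'm::{finite,linorder} \<Rightarrow> bool" where
  "ordered_alphabet T \<longleftrightarrow> strict_mono (\<lambda>i. T $ i)"

definition balanced_vec :: "int ^ 'm::finite \<Rightarrow> bool" where
  "balanced_vec \<delta> \<longleftrightarrow> (\<Sum>i\<in>UNIV. \<delta> $ i) = 0"

definition mass :: "int ^ 'm::finite \<Rightarrow> int" where
  "mass \<delta> = (\<Sum>i\<in>UNIV. max (\<delta> $ i) 0)"

definition q_relation :: "nat \<Rightarrow> int ^ 'm::finite \<Rightarrow> bool" where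
  "q_relation q \<delta> \<longleftrightarrow> balanced_vec \<delta> \<and> mass \<delta> \<le> int q"

definition pairing :: "int ^ 'm::finite \<Rightarrow> 'a::ring_1 ^ 'm \<Rightarrow> 'a" where
  "pairing \<delta> T = (\<Sum>i\<in>UNIV. of_int (\<delta> $ i) * T $ i)"

definition rat_vec :: "int ^ 'm::finite \<Rightarrow> rat ^ 'm" where
  "rat_vec \<delta> = (\<chi> i. of_int (\<delta> $ i))"

definition relation_space :: "nat \<Rightarrow> real ^ 'm::finite \<Rightarrow> (rat ^ 'm) set" where
  "relation_space q T = vec.span (rat_vec ` {\<delta>. q_relation q \<delta> \<and> pairing \<delta> T = 0})"

definition relation_rank :: "nat \<Rightarrow> real ^ 'm::finite \<Rightarrow> nat" where
  "relation_rank q T = vec.dim (relation_space q T)"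

definition primitive_balanced_generator ::
    "nat \<Rightarrow> real ^ 'm::finite \<Rightarrow> int ^ 'm \<Rightarrow> bool" where
  "primitive_balanced_generator q T \<delta> \<longleftrightarrow>
     balanced_vec \<delta> \<and> Gcd (range (\<lambda>i. \<delta> $ i)) = 1 \<and>
     vec.span {rat_vec \<delta>} = relation_space q T"

definition order_preserving_q_model ::
    "nat \<Rightarrow> real ^ 'm::{finite,linorder} \<Rightarrow> int ^ 'm::{finite,linorder} \<Rightarrow> bool" where
  "order_preserving_q_model q T T' \<longleftrightarrow>
     ordered_alphabet T' \<and>
     (\<forall>\<delta>. q_relation q \<delta> \<longrightarrow> (pairing \<delta> T = 0 \<longleftrightarrow> pairing \<delta> T' = 0))"

definition alphabet_diameter :: "int ^ 'm::{finite,linorder} \<Rightarrow> int" where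
  "alphabet_diameter T = T $ Max UNIV - T $ Min UNIV"

definition primitive_alphabet :: "int ^ 'm::{finite,linorder} \<Rightarrow> bool" where
  "primitive_alphabet T \<longleftrightarrow> Gcd (range (\<lambda>i. T $ i - T $ Min UNIV)) = 1"

end

(*
  Write C_x for the sums of the last entries of a balanced vector and g_x for the gaps of T; then the
  pairing is the sum of C_x g_x, and the mass is half the total variation of 0, C_0, ..., C_3, 0.  So
  one needs positive integral gaps g orthogonal to the tail sums c of delta, of total at most
  mu q (q+1), such that a C of total variation at most 2 q is orthogonal to g only if it is
  proportional to c; the signs of the relations that do not vanish on T are irrelevant.

  Let c be maximal at i, with value a, and minimal at j, with value -b; then a + b <= mu.  The face of
  the cone of admissible gaps on which only i and j survive is the ray through (b, a), and g is taken
  close to this ray: the two remaining gaps get values P and Q of size about h q and at most h, where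
  h = gcd a b, and g_j is the largest value that integrality and the bound on the total permit.  A
  relation vanishing on g vanishes on the ray, because g_j is large compared with what P and Q can
  contribute, and then it is proportional to c because P is large compared with Q.  When c takes its
  minimum twice this estimate is an equality, and one uses in addition that a gap lying between two
  others costs total variation.  When c takes its maximum and its minimum twice there is an explicit
  solution.
*)
theory Submission
  imports Defs
begin

section \<open>Gaps near an extreme ray\<close>

text \<open>What a total variation of at most \<open>2 * q\<close> implies for a set of tail sums
  when their order is ignored; 0 is adjoined because the sequence starts and ends at 0.\<close>

definition spread_le :: "int \<Rightarrow> int set \<Rightarrow> bool" where
  "spread_le q S \<longleftrightarrow> (\<forall>x\<in>insert 0 S. \<forall>y\<in>insert 0 S. x - y \<le> q)"

text \<open>The solutions form a residue class modulo \<open>u div gcd u v\<close>, so every window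
  of that length contains one.\<close>

lemma solve_linear_cong:
  fixes u v w :: int
  assumes "u > 0" "gcd u v dvd w"
  shows "\<exists>x. lo \<le> x \<and> x < lo + u div gcd u v \<and> u dvd v * x + w"
proof -
  define d where "d = gcd u v"
  have d: "d > 0" "d dvd u" "d dvd v" using assms(1) by (auto simp: d_def gcd_pos_int)
  obtain r s where rs: "r * u + s * v = d" using bezout_int d_def by metis
  obtain k where k: "w = d * k" using assms(2) d_def by blast
  obtain u' where u': "u = d * u'" using d by blast
  obtain v' where v': "v = d * v'" using d by blast
  have "u' > 0" using u' d assms(1) by (simp add: zero_less_mult_iff)
  \<comment> \<open>By Bezout \<open>- s * k\<close> is a solution; \<open>x\<close> is its
    representative modulo \<open>u'\<close> in the window starting at \<open>lo\<close>.\<close>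
  define x where "x = lo + (- s * k - lo) mod u'"
  have "u' dvd x + s * k"
    unfolding x_def by (smt (verit) dvd_eq_mod_eq_0 minus_mod_eq_mult_div dvd_triv_left dvd_minus_iff mult_minus_left)
  then obtain y where y: "x = u' * y - s * k" by (metis add_diff_cancel_right' dvdE)
  have "v * x + w = u * (v' * y + k * r)"
  proof -
    have "w = (r * u + s * v) * k" by (simp add: rs k)
    then show ?thesis unfolding y by (simp add: algebra_simps u' v')
  qed
  moreover have "lo \<le> x" "x < lo + u'" using \<open>u' > 0\<close> by (auto simp: x_def)
  moreover have "u div gcd u v = u'" unfolding d_def[symmetric] by (subst u') (use d in simp)
  ultimately show ?thesis by (intro exI[of _ x]) auto
qed

text \<open>The relation is \<open>c = (a, - b, - \<alpha>, - \<beta>)\<close> and the gaps are \<open>(gi, gj, P, Q)\<close>; the condition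
  \<open>lower\<close> says that \<open>gj\<close> cannot be replaced by the next value \<open>gj + a / h\<close> that keeps \<open>gi\<close> integral.\<close>

locale gap_choice =
  fixes a b \<alpha> \<beta> q \<mu> h P Q gi gj :: int
  assumes a: "a > 0" and b: "b > 0" and q: "q \<ge> 2"
    and \<mu>: "a + b \<le> \<mu>" "\<mu> \<le> q"
    and \<alpha>: "- a \<le> \<alpha>" "\<alpha> \<le> b" and \<beta>: "- a < \<beta>" "\<beta> \<le> b"
    and h: "h = gcd a b" and Q: "Q = gcd h \<alpha>"
    and P: "h * q \<le> P" and PQ: "P + Q \<le> h * (q + 1)"
    and gi: "a * gi = b * gj + \<alpha> * P + \<beta> * Q"
    and upper: "(a + b) * gj + ((a + \<alpha>) * P + (a + \<beta>) * Q) \<le> a * (\<mu> * q * (q + 1))"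
    and lower: "h * (a * (\<mu> * q * (q + 1)) - ((a + \<alpha>) * P + (a + \<beta>) * Q)) < (a + b) * (h * gj + a)"

text \<open>Two congruences are solved in turn: one for \<open>P\<close>, solvable because
  \<open>Q = gcd h \<alpha>\<close> divides \<open>\<beta> * Q\<close>, and one for
  \<open>gj\<close>, solvable because \<open>P\<close> was chosen with \<open>h\<close> dividing
  \<open>\<alpha> * P + \<beta> * Q\<close>.\<close>

lemma gap_choice_exists:
  fixes a b \<alpha> \<beta> q \<mu> :: int
  assumes "a > 0" "b > 0" "q \<ge> 2" "a + b \<le> \<mu>" "\<mu> \<le> q"
    "- a \<le> \<alpha>" "\<alpha> \<le> b" "- a < \<beta>" "\<beta> \<le> b"
  shows "\<exists>h P Q gi gj. gap_choice a b \<alpha> \<beta> q \<mu> h P Q gi gj"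
proof -
  define h where "h = gcd a b"
  define Q where "Q = gcd h \<alpha>"
  have h: "h > 0" "h dvd a" "h dvd b" using assms by (auto simp: h_def gcd_pos_int)
  have Q: "Q > 0" "Q dvd h" "Q dvd \<alpha>" using h by (auto simp: Q_def gcd_pos_int)
  obtain P where P: "h * q \<le> P" "P < h * q + h div Q" "h dvd \<alpha> * P + \<beta> * Q"
    using solve_linear_cong[of h \<alpha> "\<beta> * Q" "h * q"] h Q_def by auto
  \<comment> \<open>The window for \<open>P\<close> has length \<open>h div Q\<close>, and
    \<open>Q + h div Q\<close> is at most \<open>h + 1\<close> for every positive divisor
    \<open>Q\<close> of \<open>h\<close>.\<close>
  have PQ: "P + Q \<le> h * (q + 1)"
  proof -
    obtain r where r: "h = Q * r" using Q by blast
    have "r > 0" using r h Q by (simp add: zero_less_mult_iff)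
    have "0 \<le> (Q - 1) * (r - 1)" using \<open>r > 0\<close> Q by (intro mult_nonneg_nonneg) auto
    moreover have "h div Q = r" using r Q by simp
    ultimately have "h div Q + Q \<le> h + 1" using r by (simp add: algebra_simps)
    then show ?thesis using P(2) by (simp add: algebra_simps)
  qed
  define A where "A = (a + \<alpha>) * P + (a + \<beta>) * Q"
  \<comment> \<open>\<open>Y\<close> is the largest \<open>gj\<close> permitted by the bound on the
    total; the congruence is met once among the last \<open>a div h\<close> integers up to
    \<open>Y\<close>.\<close>
  define Y where "Y = (a * (\<mu> * q * (q + 1)) - A) div (a + b)"
  obtain gj where gj: "Y - a div h + 1 \<le> gj" "gj < Y - a div h + 1 + a div h" "a dvd b * gj + (\<alpha> * P + \<beta> * Q)"
    using solve_linear_cong[of a b "\<alpha> * P + \<beta> * Q" "Y - a div h + 1"] assms P(3) h_def by auto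
  obtain gi where gi: "b * gj + (\<alpha> * P + \<beta> * Q) = a * gi" using gj(3) by blast
  have N: "a + b > 0" using assms by simp
  have "(a + b) * gj \<le> (a + b) * Y" using gj(2) N by (intro mult_left_mono) auto
  also have "\<dots> \<le> a * (\<mu> * q * (q + 1)) - A" unfolding Y_def using N
    by (metis add.commute div_mult_mod_eq le_add_same_cancel1 mult.commute pos_mod_sign add_increasing2 order_refl)
  finally have upper: "(a + b) * gj + A \<le> a * (\<mu> * q * (q + 1))" by simp
  have "a * (\<mu> * q * (q + 1)) - A < (a + b) * (Y + 1)" unfolding Y_def using N
    by (smt (verit) mult.commute div_mult_mod_eq pos_mod_bound distrib_left mult_cancel_left1)
  also have "\<dots> \<le> (a + b) * (gj + a div h)" using gj(1) N by (intro mult_left_mono) auto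
  finally have "h * (a * (\<mu> * q * (q + 1)) - A) < h * ((a + b) * (gj + a div h))" using h by simp
  moreover have "h * (a div h) = a" using h by simp
  ultimately have lower: "h * (a * (\<mu> * q * (q + 1)) - A) < (a + b) * (h * gj + a)"
    by (metis distrib_left mult.left_commute)
  have "gap_choice a b \<alpha> \<beta> q \<mu> h P Q gi gj"
    using assms h_def Q_def P PQ gi upper lower unfolding A_def by unfold_locales (auto simp: algebra_simps)
  then show ?thesis by blast
qed

section \<open>Size and positivity of the gaps\<close>

context gap_choice
begin

lemma h_pos: "h > 0" and h_dvd: "h dvd a" "h dvd b"
  using a b h by (auto simp: gcd_pos_int)

lemma h_le: "h \<le> a" "h \<le> b"
  using h_dvd a b by (auto intro: zdvd_imp_le)

lemma a_cases: "a = h \<or> 2 * h \<le> a"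
proof -
  obtain r where r: "a = h * r" using h_dvd by blast
  then have "r > 0" using a h_pos by (simp add: zero_less_mult_iff)
  then have "r = 1 \<or> r \<ge> 2" by linarith
  then show ?thesis using r h_pos by (metis mult.commute mult.right_neutral mult_le_cancel_left_pos)
qed

lemma b_ge: "a + b \<ge> 2 * h" using h_le by simp

lemma Q_pos: "Q > 0" using Q h_pos by (simp add: gcd_pos_int)

lemma P_pos: "P > 0" using P h_pos q by (smt (verit) mult_pos_pos)

lemma bound_ge: "a * ((a + b) * q * (q + 1)) \<le> a * (\<mu> * q * (q + 1))"
  using a q \<mu> by (intro mult_left_mono mult_right_mono) auto

text \<open>The coefficients \<open>a + \<alpha>\<close> and \<open>a + \<beta>\<close> are the
  distances of the tail sums of \<open>P\<close> and \<open>Q\<close> from the maximum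
  \<open>a\<close>, while \<open>b - \<alpha>\<close> and \<open>b - \<beta>\<close> are those from
  the minimum \<open>- b\<close>.\<close>

lemma excess_eq:
  "((a + \<alpha>) * P + (a + \<beta>) * Q) + ((b - \<alpha>) * P + (b - \<beta>) * Q) = (a + b) * (P + Q)"
  by (simp add: algebra_simps)

lemma excess_nonneg: "(a + \<alpha>) * P + (a + \<beta>) * Q \<ge> 0" "(b - \<alpha>) * P + (b - \<beta>) * Q \<ge> 0"
  using P_pos Q_pos \<alpha> \<beta> by auto

lemma lower': "h * (a * ((a + b) * q * (q + 1)) - ((a + \<alpha>) * P + (a + \<beta>) * Q)) < (a + b) * (h * gj + a)"
proof -
  have "h * (a * ((a + b) * q * (q + 1)) - ((a + \<alpha>) * P + (a + \<beta>) * Q))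
     \<le> h * (a * (\<mu> * q * (q + 1)) - ((a + \<alpha>) * P + (a + \<beta>) * Q))"
    using bound_ge h_pos by (intro mult_left_mono) auto
  then show ?thesis using lower by linarith
qed

lemma hPQ: "h * (P + Q) \<le> h * (h * (q + 1))"
  using PQ h_pos by (intro mult_left_mono) auto

lemma gj_gt: "h * gj > h * a * (q * (q + 1)) - h * (h * (q + 1)) - a"
proof -
  have "h * ((a + \<alpha>) * P + (a + \<beta>) * Q) \<le> h * ((a + b) * (P + Q))"
    using excess_eq excess_nonneg h_pos by (intro mult_left_mono) auto
  also have "\<dots> = (a + b) * (h * (P + Q))" by simp
  also have "\<dots> \<le> (a + b) * (h * (h * (q + 1)))"
    using a b by (intro mult_left_mono[OF hPQ]) auto
  finally have "(a + b) * (h * a * (q * (q + 1)) - h * (h * (q + 1)) - a) < (a + b) * (h * gj)"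
    using lower' by (simp add: algebra_simps)
  then show ?thesis using a b by simp
qed

lemma gj_pos: "gj > 0"
proof -
  have "h * (h * (q + 1)) \<le> h * (a * (q + 1))" using h_le h_pos q by (intro mult_left_mono mult_right_mono) auto
  moreover have "h * a * (q * (q + 1)) - h * (a * (q + 1)) - a = a * (h * ((q - 1) * (q + 1)) - 1)"
    by (simp add: algebra_simps)
  moreover have "h * ((q - 1) * (q + 1)) \<ge> 1 * (1 * 3)" using h_pos q by (intro mult_mono) auto
  ultimately have "h * gj > 0" using gj_gt a by (smt (verit) mult_pos_pos)
  then show ?thesis using h_pos by (simp add: zero_less_mult_iff)
qed

lemma gi_pos: "gi > 0"
proof -
  let ?A = "(a + \<alpha>) * P + (a + \<beta>) * Q"
  have "b * (h * (a * ((a + b) * q * (q + 1)) - ?A)) < b * ((a + b) * (h * gj + a))"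
    using lower' b by simp
  \<comment> \<open>The expression \<open>b * gj + ?A - a * (P + Q)\<close> is
    \<open>a * gi\<close>; a multiple of it is split into the slack of the lower bound and terms
    that are nonnegative.\<close>
  moreover have "(a + b) * h * (b * gj + ?A - a * (P + Q)) - (b * ((a + b) * (h * gj + a)) - b * (h * (a * ((a + b) * q * (q + 1)) - ?A)))
     = (a + b) * a * (b * h * (q * (q + 1)) - b - h * (P + Q)) + h * a * ?A"
    by (simp add: algebra_simps)
  moreover have "(a + b) * a * (b * h * (q * (q + 1)) - b - h * (P + Q)) \<ge> 0"
  proof -
    have "h * (h * (q + 1)) \<le> h * (b * (q + 1))" using h_le h_pos q by (intro mult_left_mono mult_right_mono) auto
    moreover have "b * h * (q * (q + 1)) - b - h * (b * (q + 1)) = b * (h * ((q - 1) * (q + 1)) - 1)"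
      by (simp add: algebra_simps)
    moreover have "h * ((q - 1) * (q + 1)) \<ge> 1 * (1 * 3)" using h_pos q by (intro mult_mono) auto
    ultimately have "b * h * (q * (q + 1)) - b - h * (P + Q) \<ge> 0" using hPQ b by (smt (verit) mult_nonneg_nonneg)
    then show ?thesis using a b by simp
  qed
  moreover have "h * a * ?A \<ge> 0" using excess_nonneg h_pos a by simp
  ultimately have "(a + b) * h * (b * gj + ?A - a * (P + Q)) > 0" by linarith
  then have "b * gj + ?A - a * (P + Q) > 0"
    by (rule zero_less_mult_pos) (use a b h_pos in simp)
  moreover have "b * gj + ?A - a * (P + Q) = a * gi" unfolding gi by (simp add: algebra_simps)
  ultimately show ?thesis using a by (simp add: zero_less_mult_iff)
qed

lemma gap_sum: "gi + gj + P + Q \<le> \<mu> * q * (q + 1)"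
proof -
  have "a * (gi + gj + P + Q) = (a + b) * gj + ((a + \<alpha>) * P + (a + \<beta>) * Q)"
    using gi by (simp add: algebra_simps)
  then show ?thesis using upper a by (metis mult_le_cancel_left_pos)
qed

text \<open>The functionals that vanish on the ray and on \<open>(P, Q)\<close> are the multiples \<open>z\<close> of \<open>(Q, - P) / h\<close>, and
  \<open>z \<noteq> 0\<close> would make two of the tail sums differ by more than \<open>q\<close>.\<close>

lemma vanish_on_ray:
  assumes "\<beta> < b \<or> \<beta> \<le> \<alpha>"
    and sp: "spread_le q {Ci, Cj, CP, CQ}"
    and ray: "b * Ci + a * Cj = 0"
    and rest: "P * (a * CP + \<alpha> * Ci) + Q * (a * CQ + \<beta> * Ci) = 0"
  shows "a * CP + \<alpha> * Ci = 0 \<and> a * CQ + \<beta> * Ci = 0"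
proof -
  have nonneg: "a * CP + \<alpha> * Ci = 0 \<and> a * CQ + \<beta> * Ci = 0"
    if sp: "spread_le q {Ci, Cj, CP, CQ}"
      and ray: "b * Ci + a * Cj = 0"
      and rest: "P * (a * CP + \<alpha> * Ci) + Q * (a * CQ + \<beta> * Ci) = 0"
      and Ci: "Ci \<ge> 0" for Ci Cj CP CQ
  proof -
    obtain a' where a': "a = h * a'" using h_dvd by blast
    obtain b' where b': "b = h * b'" using h_dvd by blast
    have a'pos: "a' > 0" using a' a h_pos by (simp add: zero_less_mult_iff)
    have "coprime a' b'"
    proof -
      have "h * gcd a' b' = h" using h a' b' by (metis gcd_mult_distrib_int h_pos abs_of_pos)
      then show ?thesis using h_pos by (simp add: coprime_iff_gcd_eq_1)
    qed
    have "b' * Ci + a' * Cj = 0" using ray h_pos unfolding a' b'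
      by (metis distrib_left mult.assoc mult_eq_0_iff less_irrefl)
    then have "a' dvd b' * Ci" by (metis add.commute dvd_add_right_iff dvd_triv_left dvd_0_right)
    then have "a' dvd Ci" using \<open>coprime a' b'\<close> by (simp add: coprime_dvd_mult_right_iff)
    \<comment> \<open>The integral points of the line \<open>b * Ci + a * Cj = 0\<close> are the
      multiples of \<open>(a', - b')\<close>.\<close>
    then obtain t where t: "Ci = a' * t" by blast
    have t0: "t \<ge> 0" using Ci t a'pos by (simp add: zero_le_mult_iff)
    have Cj: "Cj = - b' * t" using \<open>b' * Ci + a' * Cj = 0\<close> a'pos t
      by (metis add_eq_0_iff less_irrefl mult.left_commute mult_cancel_left mult_minus_left mult_minus_right)
    define kP where "kP = h * CP + \<alpha> * t"
    define kQ where "kQ = h * CQ + \<beta> * t"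
    have P_eq: "a * CP + \<alpha> * Ci = a' * kP" and Q_eq: "a * CQ + \<beta> * Ci = a' * kQ"
      by (simp_all add: kP_def kQ_def a' t algebra_simps)
    have "a' * (P * kP + Q * kQ) = 0" using rest unfolding P_eq Q_eq by (simp add: algebra_simps)
    then have sum0: "P * kP + Q * kQ = 0" using a'pos by simp
    have "Q dvd kP" unfolding kP_def Q by (simp add: dvd_mult2)
    then obtain z where z: "kP = Q * z" by blast
    have zQ: "kQ = - P * z"
    proof -
      have "Q * kQ = Q * (- P * z)" using sum0 z by (simp add: algebra_simps)
      then show ?thesis using Q_pos by (metis mult_cancel_left less_irrefl)
    qed
    have "z = 0"
    proof (rule ccontr)
      assume "z \<noteq> 0"
      have hq1: "h * x \<le> h * q" if "x \<le> q" for x using that h_pos by simp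
      \<comment> \<open>For \<open>z\<close> nonzero one of these differences is too large: one
        between \<open>CP\<close> and \<open>CQ\<close> if \<open>t = 0\<close>, otherwise
        \<open>Ci - CQ\<close> if \<open>z > 0\<close>, and if \<open>z < 0\<close> either
        \<open>CQ - Cj\<close> or \<open>CQ - CP\<close>, according to the assumption on
        \<open>\<beta>\<close>.\<close>
      have sps: "CP - CQ \<le> q" "CQ - CP \<le> q" "Ci - CQ \<le> q" "CQ - Cj \<le> q"
        using sp by (auto simp: spread_le_def)
      note sph = sps[THEN hq1]
      have hCi: "h * Ci = a * t" using a' t by simp
      have hCj: "h * Cj = - b * t" using b' Cj by simp
      have hCP: "h * CP = Q * z - \<alpha> * t" using z kP_def by simp
      have hCQ: "h * CQ = - P * z - \<beta> * t" using zQ kQ_def by simp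
      have d1: "Q * z - \<alpha> * t + P * z + \<beta> * t \<le> h * q"
        "- P * z - \<beta> * t - Q * z + \<alpha> * t \<le> h * q"
        "a * t + P * z + \<beta> * t \<le> h * q"
        "- P * z - \<beta> * t + b * t \<le> h * q"
        using sph unfolding right_diff_distrib hCi hCj hCP hCQ by linarith+
      show False
      proof (cases "t = 0")
        case True
        then have "Q * z + P * z \<le> h * q" "- P * z - Q * z \<le> h * q" using d1 by simp_all
        moreover have "(P + Q) * \<bar>z\<bar> \<ge> (P + Q) * 1"
          using \<open>z \<noteq> 0\<close> P_pos Q_pos by (intro mult_left_mono) auto
        ultimately show False using P Q_pos \<open>z \<noteq> 0\<close>
          by (cases "z > 0") (auto simp: algebra_simps)
      next
        case False
        then have t1: "t > 0" using t0 by simp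
        show False
        proof (cases "z > 0")
          case True
          have "P * z \<ge> P * 1" using True P_pos by (intro mult_left_mono) auto
          moreover have "(a + \<beta>) * t > 0" using \<beta> t1 by simp
          ultimately show False using d1(3) P by (simp add: algebra_simps)
        next
          case neg: False
          then have "P * 1 \<le> P * (- z)" "Q * 1 \<le> Q * (- z)"
            using \<open>z \<noteq> 0\<close> P_pos Q_pos by (intro mult_left_mono; linarith)+
          then have z': "- (P * z) \<ge> P" "- (Q * z) \<ge> Q" by simp_all
          from assms(1) show False
          proof
            assume "\<beta> < b"
            then have "(b - \<beta>) * t > 0" using t1 by simp
            then show False using d1(4) P z' by (simp add: algebra_simps)
          next
            assume "\<beta> \<le> \<alpha>"
            then have "(\<alpha> - \<beta>) * t \<ge> 0" using t1 by simp
            then show False using d1(2) P z' Q_pos by (simp add: algebra_simps)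
          qed
        qed
      qed
    qed
    then show ?thesis using P_eq Q_eq z zQ by simp
  qed
  show ?thesis
  proof (cases "Ci \<ge> 0")
    case True
    then show ?thesis using nonneg[OF sp ray rest] by simp
  next
    case False
    have "spread_le q {- Ci, - Cj, - CP, - CQ}" using sp by (auto simp: spread_le_def)
    moreover have "b * - Ci + a * - Cj = 0" using ray by simp
    moreover have "P * (a * - CP + \<alpha> * - Ci) + Q * (a * - CQ + \<beta> * - Ci) = 0"
      using rest by (simp add: algebra_simps)
    ultimately show ?thesis using nonneg[of "- Ci" "- Cj" "- CP" "- CQ"] False by simp
  qed
qed

section \<open>Excluding relations that do not vanish on the ray\<close>

lemma lower_strict:
  assumes "\<mu> > a + b"
  shows "h * (a * ((a + b) * q * (q + 1)) - ((a + \<alpha>) * P + (a + \<beta>) * Q)) < (a + b) * (h * gj)"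
proof -
  have "(a + b + 1) * (q * (q + 1)) \<le> \<mu> * (q * (q + 1))"
    using assms q by (intro mult_right_mono) auto
  then have "h * (a * ((a + b + 1) * (q * (q + 1)))) \<le> h * (a * (\<mu> * (q * (q + 1))))"
    using a h_pos by (intro mult_left_mono) auto
  \<comment> \<open>The surplus in the bound pays for the rounding loss \<open>(a + b) * a\<close>,
    since \<open>a + b \<le> q\<close>.\<close>
  moreover have "1 * (a * ((a + b) * 1)) \<le> h * (a * (q * (q + 1)))"
    using a b h_pos q \<mu> by (intro mult_mono) auto
  ultimately show ?thesis using lower by (simp add: algebra_simps)
qed

text \<open>Multiplying by \<open>a\<close> and eliminating \<open>gi\<close> isolates the defect
  \<open>b * Ci + a * Cj\<close> on the ray. A nonzero defect is weighted by the large gap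
  \<open>gj\<close>, and the right-hand side cannot compensate for it.\<close>

lemma vanish_eq:
  assumes "Ci * gi + Cj * gj + CP * P + CQ * Q = 0"
  shows "- (b * Ci + a * Cj) * gj = P * (a * CP + \<alpha> * Ci) + Q * (a * CQ + \<beta> * Ci)"
proof -
  have "Ci * (a * gi) + a * (Cj * gj + CP * P + CQ * Q) = 0"
    using assms by (metis add.assoc distrib_left mult.left_commute mult_zero_right)
  then show ?thesis unfolding gi by (simp add: algebra_simps)
qed

text \<open>Bounding \<open>CP\<close> and \<open>CQ\<close> by \<open>q + Ci\<close> gives
  \<open>h * gj \<le> a * q * (h * (q + 1)) - A\<close>. Against the lower bound for
  \<open>gj\<close> this leaves \<open>(a + b - h) * A < (a + b) * a\<close>, and \<open>A\<close>
  is too large for that.\<close>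

lemma no_relation_neg:
  assumes \<alpha>\<beta>: "- a < \<alpha> \<or> 1 \<le> \<beta>"
    and sp: "spread_le q {Ci, Cj, CP, CQ}" and m: "m \<ge> 1" and Ci: "Ci < 0"
    and eq: "h * m * gj = P * (a * CP + \<alpha> * Ci) + Q * (a * CQ + \<beta> * Ci)"
  shows False
proof -
  define A where "A = (a + \<alpha>) * P + (a + \<beta>) * Q"
  have "CP - Ci \<le> q" "CQ - Ci \<le> q" using sp by (auto simp: spread_le_def)
  then have "a * CP \<le> a * (q + Ci)" "a * CQ \<le> a * (q + Ci)"
    using a by (auto intro!: mult_left_mono)
  moreover have "(a + \<alpha>) * Ci \<le> (a + \<alpha>) * (- 1)"
    using Ci \<alpha> by (intro mult_left_mono) auto
  moreover have "(a + \<beta>) * Ci \<le> (a + \<beta>) * (- 1)"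
    using Ci \<beta> by (intro mult_left_mono) auto
  ultimately have "a * CP + \<alpha> * Ci \<le> a * q - (a + \<alpha>)" "a * CQ + \<beta> * Ci \<le> a * q - (a + \<beta>)"
    by (simp_all add: algebra_simps)
  then have "P * (a * CP + \<alpha> * Ci) \<le> P * (a * q - (a + \<alpha>))"
    "Q * (a * CQ + \<beta> * Ci) \<le> Q * (a * q - (a + \<beta>))"
    using P_pos Q_pos by (auto intro!: mult_left_mono)
  then have "h * m * gj \<le> a * q * (P + Q) - A" unfolding eq A_def by (simp add: algebra_simps)
  moreover have "a * q * (P + Q) \<le> a * q * (h * (q + 1))"
    using PQ a q by (intro mult_left_mono) auto
  moreover have "(h * gj) * 1 \<le> (h * gj) * m" using m h_pos gj_pos by (intro mult_left_mono) auto
  ultimately have "h * gj \<le> a * q * (h * (q + 1)) - A" by (simp add: algebra_simps)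
  then have "(a + b) * (h * gj) \<le> (a + b) * (a * q * (h * (q + 1)) - A)"
    using a b by (intro mult_left_mono) auto
  then have *: "(a + b - h) * A < (a + b) * a"
    using lower' unfolding A_def[symmetric] by (simp add: algebra_simps)
  have Nh: "a + b - h \<ge> a" using h_le by simp
  show False
  proof (cases "- a < \<alpha>")
    case True
    have "P * 1 \<le> P * (a + \<alpha>)" using P_pos True by (intro mult_left_mono) auto
    moreover have "(a + \<beta>) * Q \<ge> 0" using \<beta> Q_pos by simp
    moreover have "h * q \<ge> h * (a + b)" using \<mu> h_pos by (intro mult_left_mono) auto
    moreover have "h * (a + b) \<ge> 1 * (a + b)" using h_pos a b by (intro mult_right_mono) auto
    ultimately have "A \<ge> a + b" unfolding A_def using P by (simp add: mult.commute)
    then have "(a + b - h) * A \<ge> a * (a + b)" using Nh a b by (intro mult_mono) auto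
    then show False using * by (simp add: mult.commute)
  next
    case False
    then have \<alpha>a: "\<alpha> = - a" and \<beta>1: "\<beta> \<ge> 1" using \<alpha> \<alpha>\<beta> by auto
    \<comment> \<open>With \<open>\<alpha> = - a\<close> the gap \<open>P\<close> drops out of
      \<open>A\<close>; the estimate now rests on \<open>Q = h\<close> and
      \<open>\<beta> \<ge> 1\<close>.\<close>
    have "Q = h" unfolding Q \<alpha>a using h_dvd h_pos by (simp add: gcd_proj1_iff)
    then have A: "A = (a + \<beta>) * h" by (simp add: A_def \<alpha>a)
    have "(a + b - h) * h * (a + \<beta>) \<ge> (a + b) * a"
    proof (cases "h = 1")
      case True
      have "(a + b - 1) * \<beta> \<ge> (a + b - 1) * 1" using \<beta>1 a b by (intro mult_left_mono) auto
      then show ?thesis using True b by (simp add: algebra_simps)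
    next
      case False
      then have "h \<ge> 2" using h_pos by simp
      then have "(a + b - h) * h \<ge> (a + b - h) * 2" using Nh a by (intro mult_left_mono) auto
      then have "(a + b - h) * h \<ge> a + b" using b_ge by simp
      then show ?thesis using \<beta>1 a b by (intro mult_mono) auto
    qed
    then show False using * A by (simp add: algebra_simps)
  qed
qed

lemma complement_ge:
  assumes "\<alpha> < b"
  shows "(b - \<alpha>) * P + (b - \<beta>) * Q \<ge> a + b"
proof -
  have "P * 1 \<le> P * (b - \<alpha>)" using P_pos assms by (intro mult_left_mono) auto
  moreover have "(b - \<beta>) * Q \<ge> 0" using \<beta> Q_pos by simp
  moreover have "h * q \<ge> h * (a + b)" using \<mu> h_pos by (intro mult_left_mono) auto
  moreover have "h * (a + b) \<ge> 1 * (a + b)" using h_pos a b by (intro mult_right_mono) auto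
  ultimately show ?thesis using P by (simp add: mult.commute)
qed

text \<open>Now \<open>CP\<close> and \<open>CQ\<close> are bounded by \<open>q + Cj\<close>.
  Substituting for \<open>a * Cj\<close> moves \<open>h * m * (P + Q)\<close> to the side of
  \<open>gj\<close> and subtracts \<open>B\<close>. The contradiction comes from
  \<open>B \<ge> a + b\<close> when \<open>\<alpha> < b\<close>, and from the surplus in the total
  when \<open>a + b < \<mu>\<close>.\<close>

lemma no_relation_pos:
  assumes \<alpha>\<mu>: "\<alpha> < b \<or> a + b < \<mu>"
    and sp: "spread_le q {Ci, Cj, CP, CQ}" and m: "m \<ge> 1" and Ci: "Ci > 0"
    and m_eq: "h * m = - (b * Ci + a * Cj)"
    and eq: "h * m * gj = P * (a * CP + \<alpha> * Ci) + Q * (a * CQ + \<beta> * Ci)"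
  shows False
proof -
  define A where "A = (a + \<alpha>) * P + (a + \<beta>) * Q"
  define B where "B = (b - \<alpha>) * P + (b - \<beta>) * Q"
  have AB: "A + B = (a + b) * (P + Q)" using excess_eq by (simp add: A_def B_def)
  have B0: "B \<ge> 0" using excess_nonneg by (simp add: B_def)
  have "CP - Cj \<le> q" "CQ - Cj \<le> q" using sp by (auto simp: spread_le_def)
  then have "a * CP \<le> a * (q + Cj)" "a * CQ \<le> a * (q + Cj)"
    using a by (auto intro!: mult_left_mono)
  moreover have "(b - \<alpha>) * 1 \<le> (b - \<alpha>) * Ci"
    using Ci \<alpha> by (intro mult_left_mono) auto
  moreover have "(b - \<beta>) * 1 \<le> (b - \<beta>) * Ci"
    using Ci \<beta> by (intro mult_left_mono) auto
  ultimately have "a * CP + \<alpha> * Ci \<le> a * q - h * m - (b - \<alpha>)"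
    "a * CQ + \<beta> * Ci \<le> a * q - h * m - (b - \<beta>)"
    using m_eq by (simp_all add: algebra_simps)
  then have "P * (a * CP + \<alpha> * Ci) \<le> P * (a * q - h * m - (b - \<alpha>))"
    "Q * (a * CQ + \<beta> * Ci) \<le> Q * (a * q - h * m - (b - \<beta>))"
    using P_pos Q_pos by (auto intro!: mult_left_mono)
  then have "(h * (gj + P + Q)) * m \<le> a * q * (P + Q) - B"
    using eq unfolding B_def by (simp add: algebra_simps)
  moreover have "a * q * (P + Q) \<le> a * q * (h * (q + 1))"
    using PQ a q by (intro mult_left_mono) auto
  moreover have "(h * (gj + P + Q)) * 1 \<le> (h * (gj + P + Q)) * m"
    using m h_pos gj_pos P_pos Q_pos by (intro mult_left_mono) auto
  ultimately have "h * gj \<le> a * q * (h * (q + 1)) - B - h * (P + Q)" by (simp add: algebra_simps)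
  then have "(a + b) * (h * gj) \<le> (a + b) * (a * q * (h * (q + 1)) - B - h * (P + Q))"
    using a b by (intro mult_left_mono) auto
  moreover have "h * ((a + b) * (P + Q)) = h * A + h * B" using AB by (metis distrib_left)
  ultimately have *: "(a + b) * (h * gj) \<le> (a + b) * (a * q * (h * (q + 1))) - (a + b) * B - h * A - h * B"
    by (simp add: algebra_simps)
  have NB: "(a + b) * B \<ge> 0" "h * B \<ge> 0" using B0 a b h_pos by auto
  from \<alpha>\<mu> show False
  proof
    assume "\<alpha> < b"
    then have "B \<ge> a + b" unfolding B_def using complement_ge by blast
    then have "(a + b) * B \<ge> (a + b) * (a + b)" using a b by (intro mult_left_mono) auto
    moreover have "(a + b) * (a + b) \<ge> (a + b) * a" using a b by (intro mult_left_mono) auto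
    ultimately show False using * lower' NB unfolding A_def[symmetric] by (simp add: algebra_simps)
  next
    assume "a + b < \<mu>"
    then show False using * lower_strict NB unfolding A_def[symmetric] by (simp add: algebra_simps)
  qed
qed

text \<open>Here \<open>Cj < 0\<close> lowers the bound on \<open>CP\<close> and \<open>CQ\<close>
  to \<open>q - 1\<close>. If \<open>\<alpha> < b\<close>, the comparison leaves
  \<open>(a + b) * (h * (a - h) * (q + 1)) + h * B < (a + b) * a\<close>: the first summand is too
  large if \<open>2 * h \<le> a\<close>, the second if \<open>a = h\<close>.\<close>

lemma no_relation_zero:
  assumes \<alpha>\<mu>: "\<alpha> < b \<or> a + b < \<mu>"
    and sp: "spread_le q {0, Cj, CP, CQ}" and m: "m \<ge> 1" and Cj: "Cj < 0"
    and eq: "h * m * gj = P * (a * CP) + Q * (a * CQ)"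
  shows False
proof -
  define A where "A = (a + \<alpha>) * P + (a + \<beta>) * Q"
  define B where "B = (b - \<alpha>) * P + (b - \<beta>) * Q"
  have AB: "A + B = (a + b) * (P + Q)" using excess_eq by (simp add: A_def B_def)
  have B0: "B \<ge> 0" using excess_nonneg by (simp add: B_def)
  have "CP - Cj \<le> q" "CQ - Cj \<le> q" using sp by (auto simp: spread_le_def)
  then have "P * (a * CP) \<le> P * (a * (q - 1))" "Q * (a * CQ) \<le> Q * (a * (q - 1))"
    using a P_pos Q_pos Cj by (auto intro!: mult_left_mono)
  then have "h * m * gj \<le> a * (q - 1) * (P + Q)" unfolding eq by (simp add: algebra_simps)
  moreover have "a * (q - 1) * (P + Q) \<le> a * (q - 1) * (h * (q + 1))"
    using PQ a q by (intro mult_left_mono) auto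
  moreover have "(h * gj) * 1 \<le> (h * gj) * m" using m h_pos gj_pos by (intro mult_left_mono) auto
  ultimately have "h * gj \<le> a * (q - 1) * (h * (q + 1))" by (simp add: algebra_simps)
  then have *: "(a + b) * (h * gj) \<le> (a + b) * (a * (q - 1) * (h * (q + 1)))"
    using a b by (intro mult_left_mono) auto
  have "(a + b) * (h * (P + Q)) \<le> (a + b) * (h * (h * (q + 1)))"
    using a b by (intro mult_left_mono[OF hPQ]) auto
  moreover have "(a + b) * (h * (P + Q)) = h * A + h * B" using AB by (metis distrib_left mult.left_commute)
  ultimately have hA: "h * A \<le> (a + b) * (h * (h * (q + 1))) - h * B" by linarith
  have hB: "h * B \<ge> 0" using B0 h_pos by simp
  have gap: "(a + b) * (h * (a - h) * (q + 1)) \<ge> 0"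
    using a b h_pos h_le q by simp
  from \<alpha>\<mu> show False
  proof
    assume "a + b < \<mu>"
    then show False using * hA hB gap lower_strict unfolding A_def[symmetric] by (simp add: algebra_simps)
  next
    assume "\<alpha> < b"
    have main: "(a + b) * (h * (a - h) * (q + 1)) + h * B < (a + b) * a"
      using * hA lower' unfolding A_def[symmetric] by (simp add: algebra_simps)
    from a_cases show False
    proof
      assume "a = h"
      have "B \<ge> a + b" unfolding B_def using complement_ge \<open>\<alpha> < b\<close> by blast
      then have "h * B \<ge> h * (a + b)" using h_pos by (intro mult_left_mono) auto
      then show False using main \<open>a = h\<close> by (simp add: algebra_simps)
    next
      assume "2 * h \<le> a"
      then have "1 * (a - h) * 2 \<le> h * (a - h) * (q + 1)"
        using h_pos h_le q by (intro mult_mono) auto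
      then have "a \<le> h * (a - h) * (q + 1)" using \<open>2 * h \<le> a\<close> by simp
      then have "(a + b) * a \<le> (a + b) * (h * (a - h) * (q + 1))"
        using a b by (intro mult_left_mono) auto
      then show False using main hB by simp
    qed
  qed
qed

text \<open>\<open>R\<close> stands for whatever is known of the tail sums, with or without
  information on the order of the gaps. Since it is closed under negation, excluding one sign of the
  defect forces the defect to be 0, and the argument on the ray applies.\<close>

lemma proportional:
  assumes \<alpha>\<beta>: "\<beta> < b \<or> \<beta> \<le> \<alpha>"
    and spread: "\<And>Ci Cj CP CQ. R Ci Cj CP CQ \<Longrightarrow> spread_le q {Ci, Cj, CP, CQ}"
    and sym: "\<And>Ci Cj CP CQ. R Ci Cj CP CQ \<Longrightarrow> R (- Ci) (- Cj) (- CP) (- CQ)"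
    and none: "\<And>Ci Cj CP CQ m. \<lbrakk>R Ci Cj CP CQ; m \<ge> 1; h * m = - (b * Ci + a * Cj);
      h * m * gj = P * (a * CP + \<alpha> * Ci) + Q * (a * CQ + \<beta> * Ci)\<rbrakk> \<Longrightarrow> False"
    and R: "R Ci Cj CP CQ" and vanish: "Ci * gi + Cj * gj + CP * P + CQ * Q = 0"
  shows "a * Cj = - b * Ci \<and> a * CP = - \<alpha> * Ci \<and> a * CQ = - \<beta> * Ci"
proof -
  have le: "b * Ci + a * Cj \<ge> 0"
    if R: "R Ci Cj CP CQ" and vanish: "Ci * gi + Cj * gj + CP * P + CQ * Q = 0" for Ci Cj CP CQ
  proof (rule ccontr)
    assume neg: "\<not> ?thesis"
    have "h dvd - (b * Ci + a * Cj)" using h_dvd by simp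
    then obtain m where m: "- (b * Ci + a * Cj) = h * m" by blast
    then have "h * m > 0" using neg by linarith
    then have "m \<ge> 1" using h_pos by (simp add: zero_less_mult_iff)
    then show False using none[OF R _ m[symmetric]] vanish_eq[OF vanish] m by simp
  qed
  have "b * - Ci + a * - Cj \<ge> 0"
    using vanish by (intro le[OF sym[OF R]]) (simp add: algebra_simps)
  then have "b * Ci + a * Cj = 0" using le[OF R vanish] by simp
  moreover have "P * (a * CP + \<alpha> * Ci) + Q * (a * CQ + \<beta> * Ci) = 0"
    using vanish_eq[OF vanish] calculation by simp
  ultimately have "a * CP + \<alpha> * Ci = 0 \<and> a * CQ + \<beta> * Ci = 0"
    using vanish_on_ray[OF \<alpha>\<beta> spread[OF R]] by blast
  then show ?thesis using \<open>b * Ci + a * Cj = 0\<close> by (simp add: algebra_simps)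
qed

end

section \<open>Generic gaps in three configurations of the tail sums\<close>

definition generic_gaps ::
    "(int \<Rightarrow> int \<Rightarrow> int \<Rightarrow> int \<Rightarrow> bool) \<Rightarrow> int \<Rightarrow> int \<Rightarrow> int \<Rightarrow> int \<Rightarrow> int \<Rightarrow> bool" where
  "generic_gaps R a b \<alpha> \<beta> M \<longleftrightarrow> (\<exists>gi gj gk gl.
     gi > 0 \<and> gj > 0 \<and> gk > 0 \<and> gl > 0 \<and> a * gi = b * gj + \<alpha> * gk + \<beta> * gl \<and>
     gi + gj + gk + gl \<le> M \<and>
     (\<forall>Ci Cj Ck Cl. R Ci Cj Ck Cl \<longrightarrow> Ci * gi + Cj * gj + Ck * gk + Cl * gl = 0 \<longrightarrow>
        a * Cj = - b * Ci \<and> a * Ck = - \<alpha> * Ci \<and> a * Cl = - \<beta> * Ci))"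

lemma (in gap_choice) generic_gapsI:
  assumes "\<And>Ci Cj CP CQ. R Ci Cj CP CQ \<Longrightarrow> Ci * gi + Cj * gj + CP * P + CQ * Q = 0 \<Longrightarrow>
    a * Cj = - b * Ci \<and> a * CP = - \<alpha> * Ci \<and> a * CQ = - \<beta> * Ci"
  shows "generic_gaps R a b \<alpha> \<beta> (\<mu> * q * (q + 1))"
  unfolding generic_gaps_def
  using gi_pos gj_pos P_pos Q_pos gi gap_sum assms by blast

text \<open>Differences of tail sums suffice here; the sign of \<open>Ci\<close> selects one of the
  three exclusion arguments.\<close>

lemma generic_gaps_spread:
  assumes "a > 0" "b > 0" "q \<ge> 2" "a + b \<le> \<mu>" "\<mu> \<le> q"
    and "- a \<le> \<alpha>" "\<alpha> \<le> b" "- a < \<beta>" "\<beta> < b"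
    and \<alpha>\<mu>: "\<alpha> < b \<or> a + b < \<mu>" and \<alpha>\<beta>: "- a < \<alpha> \<or> 1 \<le> \<beta>"
  shows "generic_gaps (\<lambda>Ci Cj Ck Cl. spread_le q {Ci, Cj, Ck, Cl}) a b \<alpha> \<beta> (\<mu> * q * (q + 1))"
proof -
  obtain h P Q gi gj where "gap_choice a b \<alpha> \<beta> q \<mu> h P Q gi gj"
    using gap_choice_exists[of a b q \<mu> \<alpha> \<beta>] assms by auto
  then interpret gap_choice a b \<alpha> \<beta> q \<mu> h P Q gi gj .
  show ?thesis
  proof (rule generic_gapsI, rule proportional[where R = "\<lambda>Ci Cj Ck Cl. spread_le q {Ci, Cj, Ck, Cl}"])
    fix Ci Cj CP CQ m
    assume sp: "spread_le q {Ci, Cj, CP, CQ}" and m: "1 \<le> m" "h * m = - (b * Ci + a * Cj)"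
      and eq: "h * m * gj = P * (a * CP + \<alpha> * Ci) + Q * (a * CQ + \<beta> * Ci)"
    consider "Ci < 0" | "Ci = 0" | "Ci > 0" by linarith
    then show False
    proof cases
      case 1
      then show False using no_relation_neg[OF \<alpha>\<beta> sp m(1)] eq by blast
    next
      case 2
      have "h * m > 0" using m(1) h_pos by simp
      then have "a * Cj < 0" using m(2) 2 by simp
      then have "Cj < 0" using a by (simp add: mult_less_0_iff)
      then show False using no_relation_zero[OF \<alpha>\<mu>, of Cj CP CQ m] sp m eq 2 by simp
    next
      case 3
      then show False using no_relation_pos[OF \<alpha>\<mu> sp m(1)] m(2) eq by blast
    qed
  qed (use \<open>\<beta> < b\<close> in \<open>auto simp: spread_le_def\<close>)
qed

text \<open>With \<open>\<alpha> = b\<close> the distance from the minimum no longer involves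
  \<open>P\<close> and may vanish. The lost slack is recovered from the second conjunct of the
  restriction, the variation along the positions k, j, l, available when j lies between k and
  l.\<close>

lemma generic_gaps_middle:
  assumes "a > 0" "b > 0" "q \<ge> 2" "a + b \<le> \<mu>" "\<mu> \<le> q" and \<beta>0: "0 \<le> \<beta>" "\<beta> \<le> b"
  shows "generic_gaps (\<lambda>Ci Cj Ck Cl. spread_le q {Ci, Cj, Ck, Cl} \<and>
    \<bar>Ck\<bar> + \<bar>Ck - Cj\<bar> + \<bar>Cj - Cl\<bar> + \<bar>Cl\<bar> \<le> 2 * q) a b b \<beta> (\<mu> * q * (q + 1))"
    (is "generic_gaps ?R _ _ _ _ _")
proof -
  obtain h P Q gi gj where "gap_choice a b b \<beta> q \<mu> h P Q gi gj"
    using gap_choice_exists[of a b q \<mu> b \<beta>] assms by auto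
  then interpret gap_choice a b b \<beta> q \<mu> h P Q gi gj .
  have Qh: "Q = h" unfolding Q using h_dvd h_pos by (simp add: gcd_proj1_iff)
  have Ph: "P = h * q" using P PQ unfolding Qh by (simp add: algebra_simps)
  define A where "A = (a + b) * P + (a + \<beta>) * Q"
  have A: "A \<le> (a + b) * (h * (q + 1))"
    unfolding A_def Qh Ph using \<beta>0 h_pos by (simp add: algebra_simps)
  have lowerA: "h * (a * ((a + b) * q * (q + 1)) - A) < (a + b) * (h * gj + a)"
    using lower' unfolding A_def by simp
  show ?thesis
  proof (rule generic_gapsI, rule proportional[where R = ?R])
    fix Ci Cj CP CQ m
    assume R: "?R Ci Cj CP CQ" and m: "1 \<le> m" "h * m = - (b * Ci + a * Cj)"
      and eq: "h * m * gj = P * (a * CP + b * Ci) + Q * (a * CQ + \<beta> * Ci)"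
    have eq': "m * gj = q * (a * CP + b * Ci) + (a * CQ + \<beta> * Ci)"
    proof -
      have "h * (m * gj) = h * (q * (a * CP + b * Ci) + (a * CQ + \<beta> * Ci))"
        using eq unfolding Ph Qh by (simp add: algebra_simps)
      then show ?thesis using h_pos by simp
    qed
    have hm: "h * m \<ge> h" using m(1) h_pos by simp
    consider "Ci < 0" | "Ci = 0" | "Ci > 0" by linarith
    then show False
    proof cases
      case 1
      then show False using no_relation_neg[of Ci Cj CP CQ m] R m eq a b by auto
    next
      case 2
      have "a * Cj < 0" using m(2) hm h_pos 2 by simp
      then have Cj: "Cj < 0" using a by (simp add: mult_less_0_iff)
      \<comment> \<open>A dip to \<open>Cj < 0\<close> between \<open>CP\<close> and
        \<open>CQ\<close> costs variation. The bound \<open>q - 1\<close> on both alone would only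
        give \<open>(q + 1) * (q - 1)\<close> for \<open>q * CP + CQ\<close>, and the dip improves
        it to \<open>q * (q - 1)\<close>.\<close>
      have F: "CP \<le> q - 1" "CP + CQ \<le> q - 1 \<or> CP < 0" "CQ \<le> q - 1"
        using R Cj by (auto simp: abs_if split: if_splits)
      have "q * CP + CQ \<le> q * (q - 1)"
      proof (cases "CP < 0")
        case True
        then have "q * CP \<le> q * (- 1)" using q by (intro mult_left_mono) auto
        moreover have "q * (q - 1) \<ge> q * 1" using q by (intro mult_left_mono) auto
        ultimately show ?thesis using F q by linarith
      next
        case False
        then have "(q - 1) * CP \<le> (q - 1) * (q - 1)" using F q by (intro mult_left_mono) auto
        then show ?thesis using F False by (simp add: algebra_simps)
      qed
      then have "a * (q * CP + CQ) \<le> a * (q * (q - 1))" using a by (intro mult_left_mono) auto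
      moreover have "gj * 1 \<le> gj * m" using m gj_pos by (intro mult_left_mono) auto
      ultimately have "gj \<le> a * (q * (q - 1))" using eq' 2 by (simp add: algebra_simps)
      then have "h * gj \<le> h * (a * (q * (q - 1)))" using h_pos by (intro mult_left_mono) auto
      then have "h * a * (q * (q + 1)) - h * (h * (q + 1)) - a < h * (a * (q * (q - 1)))"
        using gj_gt by linarith
      moreover have "h * (h * (q + 1)) \<le> h * (a * (q + 1))"
        using h_le h_pos q by (intro mult_left_mono mult_right_mono) auto
      moreover have "1 * (a * 1) \<le> h * (a * (q - 1))" using h_pos a q by (intro mult_mono) auto
      ultimately show False by (simp add: algebra_simps)
    next
      case 3
      have "b * Ci > 0" using b 3 by simp
      then have "a * Cj < 0" using m(2) hm h_pos by linarith
      then have Cj: "Cj < 0" using a by (simp add: mult_less_0_iff)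
      have F: "CP - Cj \<le> q" "Ci - Cj \<le> q" "CQ - Cj \<le> q"
        using R Cj by (auto simp: spread_le_def)
      \<comment> \<open>The variation along k, j, l bounds this sum by \<open>q - Cj\<close>, where
        separate bounds would give \<open>2 * q\<close>.\<close>
      have F2: "(CP - Cj) + (CQ - Cj) \<le> q - Cj"
        using R Cj by (auto simp: abs_if split: if_splits)
      have "(q - 1) * (CP - Cj) \<le> (q - 1) * q" using F q by (intro mult_left_mono) auto
      then have "q * (CP - Cj) + (CQ - Cj) \<le> q * q - Cj" using F2 by (simp add: algebra_simps)
      then have "a * (q * (CP - Cj) + (CQ - Cj)) \<le> a * (q * q - Cj)" using a by (intro mult_left_mono) auto
      moreover have "\<beta> * Ci \<le> b * Ci" using \<beta>0 3 by (intro mult_right_mono) auto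
      moreover have "q * (a * Cj) = - (q * (h * m)) - q * (b * Ci)"
        unfolding m(2) by (simp add: algebra_simps)
      ultimately have 1: "m * gj \<le> a * (q * q) - q * (h * m) + b * Ci"
        using eq' \<open>q * (a * Cj) = - (q * (h * m)) - q * (b * Ci)\<close> by (simp add: algebra_simps)
      have "a * (Ci - Cj) \<le> a * q" using F a by (intro mult_left_mono) auto
      then have "(a + b) * Ci \<le> a * q - h" using m(2) hm by (simp add: algebra_simps)
      then have "b * ((a + b) * Ci) \<le> b * (a * q - h)" using b by (intro mult_left_mono) auto
      moreover have "(a + b) * (m * gj) \<le> (a + b) * (a * (q * q) - q * (h * m) + b * Ci)"
        using 1 a b by (intro mult_left_mono) auto
      ultimately have "((a + b) * (gj + q * h)) * m \<le> (a + b) * (a * (q * q)) + b * (a * q - h)"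
        by (simp add: algebra_simps)
      moreover have "((a + b) * (gj + q * h)) * 1 \<le> ((a + b) * (gj + q * h)) * m"
        using m a b gj_pos q h_pos by (intro mult_left_mono) auto
      ultimately have 2: "(a + b) * (gj + q * h) \<le> (a + b) * (a * (q * q)) + b * (a * q - h)"
        by linarith
      have "a * q - h \<ge> a * (q - 1)" using h_le by (simp add: algebra_simps)
      show False
      proof (cases "a = 1")
        case True
        then have "h = 1" using h_le h_pos by linarith
        \<comment> \<open>For \<open>a = 1\<close> the integrality of \<open>gj\<close> has to be
          used: the strict inequality sharpens to \<open>q * q - 1 \<le> gj\<close>.\<close>
        have "(a + b) * (q * q - 1) < (a + b) * (gj + 1)"
          using lowerA A True \<open>h = 1\<close> by (simp add: algebra_simps)
        then have "q * q - 1 \<le> gj" using a b by simp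
        then have "(1 + b) * (q * q - 1 + q) \<le> (1 + b) * (gj + q)" using b by (intro mult_left_mono) auto
        then show False using 2 True \<open>h = 1\<close> q by (simp add: algebra_simps)
      next
        case False
        then have a2: "a \<ge> 2" using a by simp
        have "h * ((a + b) * (gj + q * h)) \<le> h * ((a + b) * (a * (q * q)) + b * (a * q - h))"
          using 2 h_pos by (intro mult_left_mono) auto
        moreover have "h * A \<le> h * ((a + b) * (h * (q + 1)))" using A h_pos by (intro mult_left_mono) auto
        ultimately have "a * (h * (a * q - h)) < a * (a + b)"
          using lowerA by (simp add: algebra_simps)
        then have "h * (a * q - h) < q" using a \<mu> by simp
        moreover have "h * (a * q - h) \<ge> q"
        proof (cases "h = 1")
          case True
          have "2 * q \<le> a * q" using a2 q by (intro mult_right_mono) auto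
          then show ?thesis using True q by simp
        next
          case False
          then have "2 * (2 * (q - 1)) \<le> h * (a * (q - 1))" using h_pos a2 q by (intro mult_mono) auto
          also have "\<dots> \<le> h * (a * q - h)" using \<open>a * q - h \<ge> a * (q - 1)\<close> h_pos by (intro mult_left_mono) auto
          finally show ?thesis using q by simp
        qed
        ultimately show False by simp
      qed
    qed
  qed (use \<beta>0 in \<open>auto simp: spread_le_def abs_minus_commute\<close>)
qed

text \<open>For the tail sums \<open>(a, - b, - b, a)\<close> take the gaps
  \<open>(b * n - q, a * n - 1, 1, q)\<close> with \<open>n = q * (q + 1)\<close>; their total is
  \<open>(a + b) * n\<close>. The pairing becomes
  \<open>n * (b * Ci + a * Cj) + q * (Cl - Ci) + (Ck - Cj)\<close>, which resembles a digit
  expansion, as the last two differences are at most \<open>q\<close> in absolute value.\<close>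

lemma generic_gaps_two_pairs:
  assumes a: "a > 0" and b: "b > 0" and q: "q \<ge> 2" and \<mu>: "a + b \<le> \<mu>"
  shows "generic_gaps (\<lambda>Ci Cj Ck Cl. spread_le q {Ci, Cj, Ck, Cl} \<and>
    \<bar>Ci\<bar> + \<bar>Ci - Cj\<bar> + \<bar>Cj - Ck\<bar> + \<bar>Ck\<bar> \<le> 2 * q) a b b (- a) (\<mu> * q * (q + 1))"
    (is "generic_gaps ?R _ _ _ _ _")
proof -
  define n where "n = q * (q + 1)"
  have n: "n \<ge> q * 3" using q unfolding n_def by (intro mult_left_mono) auto
  have "n \<noteq> 0" using n q by simp
  have propn: "a * Cj = - b * Ci \<and> a * Ck = - b * Ci \<and> a * Cl = - (- a) * Ci"
    if R: "?R Ci Cj Ck Cl" and van: "Ci * (b * n - q) + Cj * (a * n - 1) + Ck * 1 + Cl * q = 0" for Ci Cj Ck Cl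
  proof -
    have key: "b * Ci + a * Cj \<ge> 0 \<and> (b * Ci + a * Cj = 0 \<longrightarrow> Ci \<ge> 0 \<longrightarrow> Cl = Ci \<and> Ck = Cj)"
      if R: "?R Ci Cj Ck Cl" and van: "Ci * (b * n - q) + Cj * (a * n - 1) + Ck * 1 + Cl * q = 0" for Ci Cj Ck Cl
    proof -
      have sp: "Cl - Ci \<le> q" "Ck - Cj \<le> q" "Cl - Cj \<le> q" "Ck - Ci \<le> q" "Ci - Cl \<le> q" "Cj - Ck \<le> q" "Ci - Ck \<le> q"
        using R by (auto simp: spread_le_def)
      have eq: "n * (b * Ci + a * Cj) + q * (Cl - Ci) + (Ck - Cj) = 0"
        using van by (simp add: algebra_simps)
      have le: "q * (Cl - Ci) \<le> q * q" using sp q by (intro mult_left_mono) auto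
      have 1: "b * Ci + a * Cj \<ge> 0"
      proof (rule ccontr)
        assume neg: "\<not> ?thesis"
        then have "n * (b * Ci + a * Cj) \<le> n * (- 1)" using n q by (intro mult_left_mono) auto
        \<comment> \<open>This is the largest conceivable value, so both differences equal
          \<open>q\<close>. The spread then forces \<open>Ci = Cj\<close>, and
          \<open>(a + b) * Ci = - 1\<close> is impossible since
          \<open>a + b \<ge> 2\<close>.\<close>
        then have ge: "q * (Cl - Ci) + (Ck - Cj) \<ge> q * q + q" using eq by (simp add: n_def algebra_simps)
        then have "Ck - Cj = q" "q * (Cl - Ci) = q * q" using le sp by linarith+
        then have "Ck - Cj = q" "Cl - Ci = q" using q by auto
        then have "Ci = Cj" using sp by linarith
        then have "n * ((a + b) * Ci) = n * (- 1)"
          using eq \<open>Ck - Cj = q\<close> \<open>Cl - Ci = q\<close> by (simp add: n_def algebra_simps)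
        then have "(a + b) * Ci = - 1" using \<open>n \<noteq> 0\<close> by (metis mult_cancel_left)
        then have "\<bar>a + b\<bar> = 1" by (metis abs_minus_cancel abs_mult abs_one abs_zmult_eq_1)
        then show False using a b by simp
      qed
      have 2: "Cl = Ci \<and> Ck = Cj" if zero: "b * Ci + a * Cj = 0" and Ci: "Ci \<ge> 0"
      proof -
        \<comment> \<open>Hence \<open>Ci - Cl\<close> is -1, 0 or 1. The value 1 violates the
          variation along i, j, k, or the spread if \<open>Ci = 0\<close>; the value -1 violates the
          spread.\<close>
        have e: "Ck - Cj = q * (Ci - Cl)" using eq unfolding zero by (simp add: algebra_simps)
        have "q * (Ci - Cl) \<le> q * 1" "q * (- 1) \<le> q * (Ci - Cl)" using e sp by auto
        then have "Ci - Cl \<le> 1" "- 1 \<le> Ci - Cl" using q by (simp_all only: mult_le_cancel_left_pos)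
        moreover have "Ci - Cl \<noteq> 1"
        proof
          assume that: "Ci - Cl = 1"
          have Ck: "Ck = Cj + q" using e that by simp
          have "a * Cj \<le> 0" using zero b Ci by (smt (verit) mult_nonneg_nonneg)
          then have "Cj \<le> 0" using a by (simp add: mult_le_0_iff)
          moreover have "Ci \<noteq> 0"
          proof
            assume "Ci = 0"
            then have "Cj = 0" using zero a by simp
            then show False using Ck \<open>Ci = 0\<close> \<open>Ci - Cl = 1\<close> R by (auto simp: spread_le_def)
          qed
          ultimately show False using R Ck Ci by auto
        qed
        moreover have "Ci - Cl \<noteq> - 1"
        proof
          assume that: "Ci - Cl = - 1"
          have Ck: "Ck = Cj - q" using e that by simp
          have "a * Cj \<le> 0" using zero b Ci by (smt (verit) mult_nonneg_nonneg)
          then have "Cj \<le> 0" using a by (simp add: mult_le_0_iff)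
          then show False using Ck sp that Ci R by (auto simp: spread_le_def)
        qed
        ultimately have "Cl = Ci" by linarith
        then show ?thesis using e by simp
      qed
      show ?thesis using 1 2 by blast
    qed
    have R': "?R (- Ci) (- Cj) (- Ck) (- Cl)" using R by (auto simp: spread_le_def)
    have van': "- Ci * (b * n - q) + - Cj * (a * n - 1) + - Ck * 1 + - Cl * q = 0"
      using van by (simp add: algebra_simps)
    have zero: "b * Ci + a * Cj = 0" using key[OF R van] key[OF R' van'] by simp
    moreover have "Cl = Ci \<and> Ck = Cj" using key[OF R van] key[OF R' van'] zero by (cases "Ci \<ge> 0") auto
    ultimately show ?thesis by (simp add: algebra_simps)
  qed
  have "a * n \<ge> 1 * n" "b * n \<ge> 1 * n" using a b n q by (auto intro!: mult_right_mono)
  then have pos: "b * n - q > 0" "a * n - 1 > 0" using n q by linarith+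
  have "(a + b) * n \<le> \<mu> * n" using \<mu> n q by (intro mult_right_mono) auto
  then have sum: "(b * n - q) + (a * n - 1) + 1 + q \<le> \<mu> * q * (q + 1)"
    by (simp add: n_def algebra_simps)
  have eq: "a * (b * n - q) = b * (a * n - 1) + b * 1 + (- a) * q" by (simp add: algebra_simps)
  have "q > 0" using q by simp
  then show ?thesis unfolding generic_gaps_def
    using pos sum eq propn zero_less_one by blast
qed

section \<open>Tail sums and the order of the gaps\<close>

definition tv :: "(nat \<Rightarrow> int) \<Rightarrow> int" where
  "tv C = \<bar>C 0\<bar> + \<bar>C 1 - C 0\<bar> + \<bar>C 2 - C 1\<bar> + \<bar>C 3 - C 2\<bar> + \<bar>C 3\<bar>"

lemma lt4_cases: "x < 4 \<longleftrightarrow> x = 0 \<or> x = 1 \<or> x = 2 \<or> x = (3::nat)"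
  by auto

text \<open>A closed walk from 0 to 0 through two values covers the distance between them
  twice.\<close>

lemma tv_diff: "x < 4 \<Longrightarrow> y < 4 \<Longrightarrow> 2 * (C x - C y) \<le> tv C"
  and tv_value: "x < 4 \<Longrightarrow> 2 * \<bar>C x\<bar> \<le> tv C"
  unfolding lt4_cases tv_def by (elim disjE; simp)+

lemma tv_spread_le:
  assumes "tv C \<le> 2 * q" "i < 4" "j < 4" "k < 4" "l < 4"
  shows "spread_le q {C i, C j, C k, C l}"
proof -
  have "C x - C y \<le> q" if "x < 4" "y < 4" for x y using tv_diff[OF that, of C] assms(1) by simp
  moreover have "C x \<le> q" "- C x \<le> q" if "x < 4" for x using tv_value[OF that, of C] assms(1) by auto
  moreover have "q \<ge> 0" using tv_value[of 0 C] assms(1) by simp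
  ultimately show ?thesis using assms(2-) by (auto simp: spread_le_def)
qed

text \<open>Omitting a term does not increase the variation of a sequence.\<close>

lemma tv_middle:
  assumes "x < y" "y < z" "z < 4"
  shows "\<bar>C x\<bar> + \<bar>C x - C y\<bar> + \<bar>C y - C z\<bar> + \<bar>C z\<bar> \<le> tv C"
proof -
  consider "x = 0 \<and> y = 1 \<and> z = 2" | "x = 0 \<and> y = 1 \<and> z = 3" | "x = 0 \<and> y = 2 \<and> z = 3" | "x = 1 \<and> y = 2 \<and> z = 3"
    using assms by linarith
  then show ?thesis by cases (auto simp: tv_def)
qed

lemma perm4_distinct:
  assumes "{i, j, k, l} = {..<4::nat}"
  shows "distinct [i, j, k, l]"
proof -
  have "card (set [i, j, k, l]) = length [i, j, k, l]" by (simp only: list.set assms card_lessThan) simp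
  then show ?thesis by (rule card_distinct)
qed

text \<open>If the maximum lies outside the two minima, the climb to \<open>c l\<close> between them
  is additional variation; if it lies between them, the walk descends to \<open>- b\<close> on both
  sides of it.\<close>

lemma tv_gt_of_inner_peak:
  assumes perm: "{i, j, k, l} = {..<4::nat}" and jlk: "j < l" "l < k"
    and c: "c i > 0" "c j = - b" "c k = - b" "- b < c l" "b > 0"
  shows "2 * (c i + b) < tv c"
proof -
  have "i \<in> {..<4}" "k \<in> {..<4}" unfolding perm[symmetric] by simp_all
  then have i: "i = 0 \<or> i = 1 \<or> i = 2 \<or> i = 3" and "k < 4"
    by (simp_all only: lt4_cases lessThan_iff)
  have dist: "distinct [i, j, k, l]" by (rule perm4_distinct[OF perm])
  \<comment> \<open>One bound for each position 0, 1, 2, 3 of \<open>i\<close>, with the sign of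
    each absolute value chosen accordingly.\<close>
  have tv: "tv c \<ge> c 0 + (c 0 - c 1) + (c 2 - c 1) + (c 2 - c 3) - c 3"
    "tv c \<ge> - c 0 + (c 1 - c 0) + (c 1 - c 2) + (c 2 - c 3) - c 3"
    "tv c \<ge> - c 0 + (c 1 - c 0) + (c 2 - c 1) + (c 2 - c 3) - c 3"
    "tv c \<ge> - c 0 + (c 1 - c 0) + (c 1 - c 2) + (c 3 - c 2) + c 3"
    unfolding tv_def
    using abs_ge_self[of "c 0"] abs_ge_minus_self[of "c 0"] abs_ge_self[of "c 3"] abs_ge_minus_self[of "c 3"]
      abs_ge_self[of "c 1 - c 0"] abs_ge_minus_self[of "c 1 - c 0"]
      abs_ge_self[of "c 2 - c 1"] abs_ge_minus_self[of "c 2 - c 1"]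
      abs_ge_self[of "c 3 - c 2"] abs_ge_minus_self[of "c 3 - c 2"]
    by simp_all
  consider "j = 0 \<and> l = 1 \<and> k = 2" | "j = 0 \<and> l = 1 \<and> k = 3"
    | "j = 0 \<and> l = 2 \<and> k = 3" | "j = 1 \<and> l = 2 \<and> k = 3"
    using jlk \<open>k < 4\<close> by linarith
  then show ?thesis
  proof cases
    case 1
    then have "i = 3" using i dist by auto
    then show ?thesis using tv c 1 by simp
  next
    case 2
    then have "i = 2" using i dist by auto
    then show ?thesis using tv c 2 by simp
  next
    case 3
    then have "i = 1" using i dist by auto
    then show ?thesis using tv c 3 by simp
  next
    case 4
    then have "i = 0" using i dist by auto
    then show ?thesis using tv c 4 by simp
  qed
qed

text \<open>Cross products express proportionality to \<open>c\<close> without singling out a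
  nonzero entry.\<close>

definition has_generic_gaps :: "int \<Rightarrow> (nat \<Rightarrow> int) \<Rightarrow> int \<Rightarrow> bool" where
  "has_generic_gaps q c M \<longleftrightarrow> (\<exists>g. (\<forall>x<4. g x > 0) \<and> (\<Sum>x<4. c x * g x) = 0 \<and> (\<Sum>x<4. g x) \<le> M \<and>
     (\<forall>C. tv C \<le> 2 * q \<longrightarrow> (\<Sum>x<4. C x * g x) = 0 \<longrightarrow> (\<forall>x<4. \<forall>y<4. C x * c y = C y * c x)))"

lemma sum_perm4:
  fixes f :: "nat \<Rightarrow> int"
  assumes "{i, j, k, l} = {..<4::nat}"
  shows "(\<Sum>x<4. f x) = f i + f j + f k + f l"
  using perm4_distinct[OF assms] unfolding assms[symmetric] by simp

lemma has_generic_gapsI: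
  assumes perm: "{i, j, k, l} = {..<4::nat}"
    and gen: "generic_gaps R (c i) (- c j) (- c k) (- c l) M" and ci: "c i > 0"
    and R: "\<And>C. tv C \<le> 2 * q \<Longrightarrow> R (C i) (C j) (C k) (C l)"
  shows "has_generic_gaps q c M"
proof -
  obtain gi gj gk gl where g: "gi > 0" "gj > 0" "gk > 0" "gl > 0"
    "c i * gi = - c j * gj + - c k * gk + - c l * gl" "gi + gj + gk + gl \<le> M"
    and gen': "\<And>Ci Cj Ck Cl. R Ci Cj Ck Cl \<Longrightarrow> Ci * gi + Cj * gj + Ck * gk + Cl * gl = 0 \<Longrightarrow>
        c i * Cj = c j * Ci \<and> c i * Ck = c k * Ci \<and> c i * Cl = c l * Ci"
    using gen unfolding generic_gaps_def by (simp only: minus_minus) blast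
  define g' where "g' x = (if x = i then gi else if x = j then gj else if x = k then gk else gl)" for x
  have dist: "distinct [i, j, k, l]" by (rule perm4_distinct[OF perm])
  have g': "g' i = gi" "g' j = gj" "g' k = gk" "g' l = gl" using dist by (auto simp: g'_def)
  have "C x * c y = C y * c x"
    if C: "tv C \<le> 2 * q" "(\<Sum>x<4. C x * g' x) = 0" and xy: "x < 4" "y < 4" for C x y
  proof -
    have "c i * C j = c j * C i \<and> c i * C k = c k * C i \<and> c i * C l = c l * C i"
      using C(2) unfolding sum_perm4[OF perm] g' by (rule gen'[OF R[OF C(1)]])
    moreover have "x \<in> {i, j, k, l}" "y \<in> {i, j, k, l}" using xy perm by auto
    ultimately have "c i * C x = c x * C i" "c i * C y = c y * C i" by auto
    then have "(c i * C x) * c y = (c i * C y) * c x" by (simp only: ac_simps)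
    then have "c i * (C x * c y) = c i * (C y * c x)" by (simp only: mult.assoc)
    then show ?thesis using ci by simp
  qed
  moreover have "(\<Sum>x<4. c x * g' x) = 0" "(\<Sum>x<4. g' x) \<le> M"
    unfolding sum_perm4[OF perm] g' using g(5,6) by auto
  moreover have "\<forall>x<4. g' x > 0" using g by (auto simp: g'_def)
  ultimately show ?thesis unfolding has_generic_gaps_def by blast
qed

lemma has_generic_gaps_uminus:
  assumes "has_generic_gaps q (\<lambda>x. - c x) M"
  shows "has_generic_gaps q c M"
  using assms unfolding has_generic_gaps_def by (simp add: sum_negf)

section \<open>Cases by the positions of the maxima and minima\<close>

locale integer_relation =
  fixes c :: "nat \<Rightarrow> int" and q \<mu> :: int and i j k l :: nat
  assumes q: "q \<ge> 2" and \<mu>: "2 * \<mu> = tv c" "\<mu> \<le> q"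
    and perm: "{i, j, k, l} = {..<4}"
    and ci: "c i > 0" and cj: "c j < 0"
    and max_i: "\<And>x. x < 4 \<Longrightarrow> c x \<le> c i" and min_j: "\<And>x. x < 4 \<Longrightarrow> c j \<le> c x"
begin

lemma perms: "{j, i, k, l} = {..<4}" "{i, j, l, k} = {..<4}" "{i, k, j, l} = {..<4}"
    "{l, j, k, i} = {..<4}" "{i, l, j, k} = {..<4}"
  unfolding perm[symmetric] by auto

lemma lt4: "i < 4" "j < 4" "k < 4" "l < 4" using perm by auto

lemma mass_ge: "c i + - c j \<le> \<mu>"
  using tv_diff[of i j c] lt4 \<mu> by simp

lemma flip: "integer_relation (\<lambda>x. - c x) q \<mu> j i k l"
proof
  show "2 * \<mu> = tv (\<lambda>x. - c x)" using \<mu> by (simp add: tv_def abs_minus_commute)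
  show "{j, i, k, l} = {..<4}" by (rule perms)
qed (use q \<mu> ci cj max_i min_j in simp_all)

lemma swap: "integer_relation c q \<mu> i j l k"
  by standard (use q \<mu> perms ci cj max_i min_j in auto)

lemma spread_case:
  assumes "c j < c l" "c l < c i" "c j < c k \<or> c i - c j < \<mu>" "c k < c i \<or> c l < 0"
  shows "has_generic_gaps q c (\<mu> * q * (q + 1))"
proof (rule has_generic_gapsI[where c = c and i = i and j = j and k = k and l = l, OF perm _ ci])
  show "generic_gaps (\<lambda>Ci Cj Ck Cl. spread_le q {Ci, Cj, Ck, Cl}) (c i) (- c j) (- c k) (- c l) (\<mu> * q * (q + 1))"
    using assms q \<mu>(2) mass_ge ci cj max_i[OF lt4(3)] min_j[OF lt4(3)] by (intro generic_gaps_spread) auto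
qed (use tv_spread_le lt4 in blast)

lemma middle_case:
  assumes "c k = c j" "c l \<le> 0" "k < j \<and> j < l \<or> l < j \<and> j < k"
  shows "has_generic_gaps q c (\<mu> * q * (q + 1))"
proof (rule has_generic_gapsI[where c = c and i = i and j = j and k = k and l = l, OF perm _ ci])
  show "generic_gaps (\<lambda>Ci Cj Ck Cl. spread_le q {Ci, Cj, Ck, Cl} \<and>
    \<bar>Ck\<bar> + \<bar>Ck - Cj\<bar> + \<bar>Cj - Cl\<bar> + \<bar>Cl\<bar> \<le> 2 * q) (c i) (- c j) (- c k) (- c l) (\<mu> * q * (q + 1))"
    unfolding assms(1) using assms q \<mu>(2) mass_ge ci cj min_j[OF lt4(4)] by (intro generic_gaps_middle) auto
  show "spread_le q {C i, C j, C k, C l} \<and> \<bar>C k\<bar> + \<bar>C k - C j\<bar> + \<bar>C j - C l\<bar> + \<bar>C l\<bar> \<le> 2 * q"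
    if "tv C \<le> 2 * q" for C
    using that tv_spread_le[OF that] lt4 assms(3) tv_middle[of k j l C] tv_middle[of l j k C] by fastforce
qed

lemma two_pairs_case:
  assumes "c k = c j" "c l = c i" "i < j \<and> j < k \<or> k < j \<and> j < i"
  shows "has_generic_gaps q c (\<mu> * q * (q + 1))"
proof (rule has_generic_gapsI[where c = c and i = i and j = j and k = k and l = l, OF perm _ ci])
  show "generic_gaps (\<lambda>Ci Cj Ck Cl. spread_le q {Ci, Cj, Ck, Cl} \<and>
    \<bar>Ci\<bar> + \<bar>Ci - Cj\<bar> + \<bar>Cj - Ck\<bar> + \<bar>Ck\<bar> \<le> 2 * q) (c i) (- c j) (- c k) (- c l) (\<mu> * q * (q + 1))"
    unfolding assms(1,2) using q mass_ge ci cj by (intro generic_gaps_two_pairs) auto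
  show "spread_le q {C i, C j, C k, C l} \<and> \<bar>C i\<bar> + \<bar>C i - C j\<bar> + \<bar>C j - C k\<bar> + \<bar>C k\<bar> \<le> 2 * q"
    if "tv C \<le> 2 * q" for C
    using that tv_spread_le[OF that] lt4 assms(3) tv_middle[of i j k C] tv_middle[of k j i C] by fastforce
qed

lemma swap_min:
  assumes "c k = c j"
  shows "integer_relation c q \<mu> i k j l"
  by standard (use q \<mu> perms ci cj max_i min_j assms in auto)

lemma swap_max:
  assumes "c l = c i"
  shows "integer_relation c q \<mu> l j k i"
  by standard (use q \<mu> perms ci cj max_i min_j assms in auto)

lemma distinct_indices: "distinct [i, j, k, l]"
  by (rule perm4_distinct[OF perm])

text \<open>The cases depend on which of j, k, l is in the middle. For j or k the variation along
  the three is used, after exchanging the minima if necessary. If l is in the middle, either it is a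
  third minimum and takes the role of j, or the peak at l makes the mass exceed
  \<open>c i - c j\<close>.\<close>

lemma double_min_case:
  assumes ck: "c k = c j" and cl: "c l \<le> 0"
  shows "has_generic_gaps q c (\<mu> * q * (q + 1))"
proof -
  interpret k: integer_relation c q \<mu> i k j l by (rule swap_min[OF ck])
  consider "k < j \<and> j < l \<or> l < j \<and> j < k" | "j < k \<and> k < l \<or> l < k \<and> k < j"
    | "j < l \<and> l < k \<or> k < l \<and> l < j"
    using distinct_indices lt4 unfolding lt4_cases by (elim disjE; simp)
  then show ?thesis
  proof cases
    case 1
    then show ?thesis using middle_case ck cl by blast
  next
    case 2
    then show ?thesis using k.middle_case ck cl by simp
  next
    case 3
    show ?thesis
    proof (cases "c l = c j")
      case True
      interpret l: integer_relation c q \<mu> i l j k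
        by standard (use q \<mu> perms ci cj max_i min_j True in auto)
      show ?thesis using l.middle_case ck True cj 3 by auto
    next
      case False
      then have "c j < c l" using min_j[OF lt4(4)] by simp
      moreover have "c i - c j < \<mu>"
      proof -
        have "2 * (c i + - c j) < tv c"
          using 3
        proof (elim disjE conjE)
          assume "j < l" "l < k"
          then show ?thesis
            by (rule tv_gt_of_inner_peak[OF perm]) (use ci cj ck \<open>c j < c l\<close> in auto)
        next
          assume "k < l" "l < j"
          then show ?thesis
            by (rule tv_gt_of_inner_peak[OF perms(3)]) (use ci cj ck \<open>c j < c l\<close> in auto)
        qed
        then show ?thesis using \<mu>(1) by simp
      qed
      ultimately show ?thesis using spread_case ci cl ck cj by auto
    qed
  qed
qed

text \<open>In every order some extremum lies between one of its own kind and one of the other kind.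
  Relabelling reduces to \<open>two_pairs_case\<close>, preceded by negation if that extremum is a
  maximum.\<close>

lemma two_pairs:
  assumes ck: "c k = c j" and cl: "c l = c i"
  shows "has_generic_gaps q c (\<mu> * q * (q + 1))"
proof -
  interpret k: integer_relation c q \<mu> i k j l by (rule swap_min[OF ck])
  interpret l: integer_relation c q \<mu> l j k i by (rule swap_max[OF cl])
  interpret lk: integer_relation c q \<mu> l k j i by (rule k.swap_max[OF cl])
  interpret f: integer_relation "\<lambda>x. - c x" q \<mu> j i l k
    using integer_relation.swap[OF flip] .
  interpret fl: integer_relation "\<lambda>x. - c x" q \<mu> j l i k
    using f.swap_min cl by simp
  have "(i < j \<and> j < k \<or> k < j \<and> j < i) \<or> (i < k \<and> k < j \<or> j < k \<and> k < i) \<or>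
    (l < j \<and> j < k \<or> k < j \<and> j < l) \<or> (l < k \<and> k < j \<or> j < k \<and> k < l) \<or>
    (j < i \<and> i < l \<or> l < i \<and> i < j) \<or> (j < l \<and> l < i \<or> i < l \<and> l < j)"
    using distinct_indices lt4 unfolding lt4_cases by (elim disjE; simp)
  moreover have "i < j \<and> j < k \<or> k < j \<and> j < i \<Longrightarrow> ?thesis"
    using two_pairs_case ck cl by blast
  moreover have "i < k \<and> k < j \<or> j < k \<and> k < i \<Longrightarrow> ?thesis"
    using k.two_pairs_case ck cl by presburger
  moreover have "l < j \<and> j < k \<or> k < j \<and> j < l \<Longrightarrow> ?thesis"
    using l.two_pairs_case ck cl by presburger
  moreover have "l < k \<and> k < j \<or> j < k \<and> k < l \<Longrightarrow> ?thesis"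
    using lk.two_pairs_case ck cl by presburger
  moreover have "j < i \<and> i < l \<or> l < i \<and> i < j \<Longrightarrow> ?thesis"
    by (rule has_generic_gaps_uminus, rule f.two_pairs_case) (use ck cl in auto)
  moreover have "j < l \<and> l < i \<or> i < l \<and> l < j \<Longrightarrow> ?thesis"
    by (rule has_generic_gaps_uminus, rule fl.two_pairs_case) (use ck cl in auto)
  ultimately show ?thesis by argo
qed

text \<open>If \<open>0 < c l < c i\<close>, negation turns the double minimum into a double maximum
  and makes the remaining tail sum negative, which is covered by \<open>spread_case\<close>.\<close>

lemma min_case:
  assumes ck: "c k = c j"
  shows "has_generic_gaps q c (\<mu> * q * (q + 1))"
proof -
  consider "c l \<le> 0" | "c l = c i" | "0 < c l" "c l < c i" using max_i[OF lt4(4)] by linarith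
  then show ?thesis
  proof cases
    case 1
    then show ?thesis using double_min_case ck by blast
  next
    case 2
    then show ?thesis using two_pairs ck by blast
  next
    case 3
    interpret f: integer_relation "\<lambda>x. - c x" q \<mu> j i k l by (rule flip)
    have "has_generic_gaps q (\<lambda>x. - c x) (\<mu> * q * (q + 1))"
      using f.spread_case 3 ck ci cj by simp
    then show ?thesis by (rule has_generic_gaps_uminus)
  qed
qed

lemma generic_gaps: "has_generic_gaps q c (\<mu> * q * (q + 1))"
proof -
  interpret s: integer_relation c q \<mu> i j l k by (rule swap)
  interpret f: integer_relation "\<lambda>x. - c x" q \<mu> j i k l by (rule flip)
  interpret fs: integer_relation "\<lambda>x. - c x" q \<mu> j i l k by (rule f.swap)
  consider "c k = c j" | "c l = c j" | "c k = c i" | "c l = c i"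
    | "c j < c k" "c k < c i" "c j < c l" "c l < c i"
    using max_i[OF lt4(3)] max_i[OF lt4(4)] min_j[OF lt4(3)] min_j[OF lt4(4)]
    unfolding le_less by metis
  then show ?thesis
  proof cases
    case 1
    then show ?thesis by (rule min_case)
  next
    case 2
    then show ?thesis by (rule s.min_case)
  next
    case 3
    then show ?thesis by (intro has_generic_gaps_uminus[OF f.min_case]) simp
  next
    case 4
    then show ?thesis by (intro has_generic_gaps_uminus[OF fs.min_case]) simp
  next
    case 5
    then show ?thesis by (intro spread_case) auto
  qed
qed

end

lemma generic_gaps_exist:
  fixes c :: "nat \<Rightarrow> int"
  assumes "q \<ge> 2" "2 * \<mu> = tv c" "\<mu> \<le> q" "x < 4" "c x > 0" "y < 4" "c y < 0"
  shows "has_generic_gaps q c (\<mu> * q * (q + 1))"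
proof -
  have fin: "finite (c ` {..<4})" "c ` {..<4} \<noteq> {}" using assms(4) by auto
  obtain i where i: "i < 4" "c i = Max (c ` {..<4})" using Max_in[OF fin] by auto
  obtain j where j: "j < 4" "c j = Min (c ` {..<4})" using Min_in[OF fin] by auto
  have max: "c x \<le> c i" if "x < 4" for x using i(2) that by simp
  have min: "c j \<le> c x" if "x < 4" for x using j(2) that by simp
  have ci: "c i > 0" and cj: "c j < 0" using max[OF assms(4)] min[OF assms(6)] assms by auto
  then have "i \<noteq> j" by auto
  then have "card ({..<4} - {i, j}) = 2" using i j by (subst card_Diff_subset) auto
  then obtain k l where "{..<4} - {i, j} = {k, l}" by (auto simp: card_2_iff)
  then have "{i, j, k, l} = {..<4}" using i(1) j(1) by auto
  then interpret integer_relation c q \<mu> i j k l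
    using assms max min ci cj by unfold_locales auto
  show ?thesis by (rule generic_gaps)
qed

text \<open>All conditions but the bound are homogeneous in the gaps, and dividing by the gcd does
  not increase the total.\<close>

lemma has_generic_gaps_primitive:
  assumes "has_generic_gaps q c M"
  shows "\<exists>g. (\<forall>x<4. g x > 0) \<and> Gcd (g ` {..<4}) = 1 \<and> (\<Sum>x<4. c x * g x) = 0 \<and> (\<Sum>x<4. g x) \<le> M \<and>
    (\<forall>C. tv C \<le> 2 * q \<longrightarrow> (\<Sum>x<4. C x * g x) = 0 \<longrightarrow> (\<forall>x<4. \<forall>y<4. C x * c y = C y * c x))"
proof -
  obtain g where g: "\<And>x. x < 4 \<Longrightarrow> g x > 0" "(\<Sum>x<4. c x * g x) = 0" "(\<Sum>x<4. g x) \<le> M"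
    and gen: "\<And>C x y. tv C \<le> 2 * q \<Longrightarrow> (\<Sum>x<4. C x * g x) = 0 \<Longrightarrow> x < 4 \<Longrightarrow> y < 4 \<Longrightarrow> C x * c y = C y * c x"
    using assms unfolding has_generic_gaps_def by blast
  define d where "d = Gcd (g ` {..<4})"
  define g' where "g' x = g x div d" for x
  have dvd: "d dvd g x" if "x < 4" for x unfolding d_def by (rule Gcd_dvd) (use that in simp)
  have g': "g x = d * g' x" if "x < 4" for x using dvd[OF that] by (simp add: g'_def)
  have "d \<noteq> 0" using g'[of 0] g(1)[of 0] by auto
  moreover have "d \<ge> 0" unfolding d_def by simp
  ultimately have d: "d > 0" by simp
  have pos: "g' x > 0" if "x < 4" for x using g'[OF that] g(1)[OF that] d by (simp add: zero_less_mult_iff)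
  have scale: "(\<Sum>x<4. C x * g x) = d * (\<Sum>x<4. C x * g' x)" for C
    unfolding sum_distrib_left by (rule sum.cong) (use g' in auto)
  have "d * Gcd (g' ` {..<4}) dvd d"
  proof -
    have "d * Gcd (g' ` {..<4}) dvd g x" if "x < 4" for x
      unfolding g'[OF that] by (intro mult_dvd_mono Gcd_dvd) (use that in auto)
    then have "d * Gcd (g' ` {..<4}) dvd Gcd (g ` {..<4})" by (intro Gcd_greatest) auto
    then show ?thesis by (simp add: d_def)
  qed
  then have "Gcd (g' ` {..<4}) dvd 1" using d by simp
  moreover have "Gcd (g' ` {..<4}) \<ge> 0" by simp
  ultimately have prim: "Gcd (g' ` {..<4}) = 1" by simp
  have "(\<Sum>x<4. g' x) \<le> (\<Sum>x<4. g x)"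
  proof (rule sum_mono)
    fix x :: nat assume "x \<in> {..<4}"
    then have "x < 4" by simp
    have "1 * g' x \<le> d * g' x" using d pos[OF \<open>x < 4\<close>] by (intro mult_right_mono) auto
    then show "g' x \<le> g x" using g'[OF \<open>x < 4\<close>] by simp
  qed
  then have "(\<Sum>x<4. g' x) \<le> M" using g(3) by simp
  moreover have "(\<Sum>x<4. c x * g' x) = 0" using g(2) d unfolding scale by simp
  moreover have "\<forall>C. tv C \<le> 2 * q \<longrightarrow> (\<Sum>x<4. C x * g' x) = 0 \<longrightarrow> (\<forall>x<4. \<forall>y<4. C x * c y = C y * c x)"
    using gen unfolding scale by simp
  ultimately show ?thesis using pos prim by blast
qed

section \<open>Alphabets with five letters\<close>

lemma less_5: "(0::5) < 1" "(1::5) < 2" "(2::5) < 3" "(3::5) < 4"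
  by (simp_all add: less_bit1_def bit1.Rep_numeral bit1.Rep_0 bit1.Rep_1)

lemma UNIV_5: "UNIV = {0, 1, 2, 3, 4 :: 5}"
  by (rule sym, rule card_seteq) auto

lemma sum_5: "(\<Sum>i\<in>UNIV. f (i::5)) = f 0 + f 1 + f 2 + f 3 + (f 4 :: 'a::comm_monoid_add)"
  unfolding UNIV_5 by (simp add: add.assoc)

lemma forall_5: "(\<forall>i::5. P i) \<longleftrightarrow> P 0 \<and> P 1 \<and> P 2 \<and> P 3 \<and> P 4"
proof -
  have "(\<forall>i. P i) \<longleftrightarrow> (\<forall>i\<in>UNIV. P i)" by simp
  then show ?thesis unfolding UNIV_5 by simp
qed

lemma Min_5: "Min (UNIV :: 5 set) = 0" and Max_5: "Max (UNIV :: 5 set) = 4"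
proof -
  have "(0::5) < 1" "(0::5) < 2" "(0::5) < 3" "(0::5) < 4" "(1::5) < 4" "(2::5) < 4" "(3::5) < 4"
    using less_5 by (meson less_trans)+
  then have "\<forall>y::5. 0 \<le> y" "\<forall>y::5. y \<le> 4"
    unfolding forall_5 by (simp_all add: less_imp_le)
  then show "Min (UNIV :: 5 set) = 0" "Max (UNIV :: 5 set) = 4"
    by (auto intro!: Min_eqI Max_eqI)
qed

lemma ordered_alphabet_5:
  fixes T :: "'a::linorder ^ 5"
  shows "ordered_alphabet T \<longleftrightarrow> T $ 0 < T $ 1 \<and> T $ 1 < T $ 2 \<and> T $ 2 < T $ 3 \<and> T $ 3 < T $ 4"
proof
  assume "ordered_alphabet T"
  then show "T $ 0 < T $ 1 \<and> T $ 1 < T $ 2 \<and> T $ 2 < T $ 3 \<and> T $ 3 < T $ 4"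
    unfolding ordered_alphabet_def strict_mono_def using less_5 by blast
next
  assume T: "T $ 0 < T $ 1 \<and> T $ 1 < T $ 2 \<and> T $ 2 < T $ 3 \<and> T $ 3 < T $ 4"
  then have "T $ 0 < T $ 2" "T $ 0 < T $ 3" "T $ 0 < T $ 4" "T $ 1 < T $ 3" "T $ 1 < T $ 4" "T $ 2 < T $ 4"
    by (meson less_trans)+
  then have "\<forall>x y. x < y \<longrightarrow> T $ x < T $ y"
    unfolding forall_5 using T
    by (simp add: less_bit1_def bit1.Rep_numeral bit1.Rep_0 bit1.Rep_1)
  then show "ordered_alphabet T" by (simp add: ordered_alphabet_def strict_mono_def)
qed

text \<open>For a balanced vector \<open>\<delta>\<close>, Abel summation turns \<open>pairing \<delta> T\<close> into the pairing of the tail sums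
  of \<open>\<delta>\<close> with the gaps of \<open>T\<close>.\<close>

definition tail_sum :: "int ^ 5 \<Rightarrow> nat \<Rightarrow> int" where
  "tail_sum \<delta> x = [\<delta> $ 1 + \<delta> $ 2 + \<delta> $ 3 + \<delta> $ 4, \<delta> $ 2 + \<delta> $ 3 + \<delta> $ 4, \<delta> $ 3 + \<delta> $ 4, \<delta> $ 4] ! x"

definition gap :: "'a::ab_group_add ^ 5 \<Rightarrow> nat \<Rightarrow> 'a" where
  "gap T x = [T $ 1 - T $ 0, T $ 2 - T $ 1, T $ 3 - T $ 2, T $ 4 - T $ 3] ! x"

lemma tail_sum_simps [simp]:
  "tail_sum \<delta> 0 = \<delta> $ 1 + \<delta> $ 2 + \<delta> $ 3 + \<delta> $ 4" "tail_sum \<delta> (Suc 0) = \<delta> $ 2 + \<delta> $ 3 + \<delta> $ 4"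
  "tail_sum \<delta> 2 = \<delta> $ 3 + \<delta> $ 4" "tail_sum \<delta> 3 = \<delta> $ 4"
  by (simp_all add: tail_sum_def)

lemma gap_simps [simp]:
  "gap T 0 = T $ 1 - T $ 0" "gap T (Suc 0) = T $ 2 - T $ 1" "gap T 2 = T $ 3 - T $ 2" "gap T 3 = T $ 4 - T $ 3"
  by (simp_all add: gap_def)

lemma sum_4: "(\<Sum>x<4. f x) = f 0 + f (Suc 0) + f 2 + (f 3 :: 'a::comm_monoid_add)"
  by (simp add: eval_nat_numeral add.assoc)

lemma balanced_5: "balanced_vec (\<delta> :: int ^ 5) \<Longrightarrow> \<delta> $ 0 = - (\<delta> $ 1 + \<delta> $ 2 + \<delta> $ 3 + \<delta> $ 4)"
  unfolding balanced_vec_def sum_5 by linarith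

lemma pairing_eq_gap_sum:
  fixes T :: "'a::comm_ring_1 ^ 5"
  assumes "balanced_vec \<delta>"
  shows "pairing \<delta> T = (\<Sum>x<4. of_int (tail_sum \<delta> x) * gap T x)"
  unfolding pairing_def sum_5 sum_4 balanced_5[OF assms] by (simp add: algebra_simps)

text \<open>Balance makes the mass half the sum of the absolute entries, and up to sign the entries
  are the increments of the tail sums padded with 0.\<close>

lemma mass_eq_tv:
  assumes "balanced_vec (\<delta> :: int ^ 5)"
  shows "2 * mass \<delta> = tv (tail_sum \<delta>)"
proof -
  have "2 * max x 0 = \<bar>x\<bar> + x" for x :: int by simp
  then have "2 * mass \<delta> = (\<Sum>i\<in>UNIV. \<bar>\<delta> $ i\<bar>) + (\<Sum>i\<in>UNIV. \<delta> $ i)"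
    unfolding mass_def sum_distrib_left by (simp add: sum.distrib)
  then have "2 * mass \<delta> = (\<Sum>i\<in>UNIV. \<bar>\<delta> $ i\<bar>)" using assms by (simp add: balanced_vec_def)
  moreover have "tail_sum \<delta> 0 = - \<delta> $ 0" "tail_sum \<delta> 1 - tail_sum \<delta> 0 = - \<delta> $ 1"
    "tail_sum \<delta> 2 - tail_sum \<delta> 1 = - \<delta> $ 2" "tail_sum \<delta> 3 - tail_sum \<delta> 2 = - \<delta> $ 3"
    using balanced_5[OF assms] by simp_all
  ultimately show ?thesis by (simp only: sum_5 tv_def abs_minus_cancel tail_sum_simps)
qed

lemma ordered_alphabet_gap:
  fixes T :: "'a::linordered_idom ^ 5"
  shows "ordered_alphabet T \<longleftrightarrow> (\<forall>x<4. gap T x > 0)"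
  unfolding ordered_alphabet_5 lt4_cases by auto

section \<open>The relation space and the integer model\<close>

lemma relation_multiple:
  assumes gen: "primitive_balanced_generator q T \<delta>"
    and "q_relation q \<epsilon>" "pairing \<epsilon> T = 0"
  shows "\<exists>k. \<forall>i. \<epsilon> $ i = k * \<delta> $ i"
proof -
  have "rat_vec \<epsilon> \<in> relation_space q T"
    unfolding relation_space_def using assms by (intro vec.span_base) auto
  then have "rat_vec \<epsilon> \<in> vec.span {rat_vec \<delta>}" using gen by (simp add: primitive_balanced_generator_def)
  then obtain r where r: "rat_vec \<epsilon> = r *s rat_vec \<delta>" by (auto simp: vec.span_singleton)
  obtain p s where ps: "r = of_int p / of_int s" "s > 0" "coprime p s"
    using quotient_of_unique[of r] by (metis prod.collapse quotient_of_coprime quotient_of_denom_pos quotient_of_div)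
  have eq: "s * \<epsilon> $ i = p * \<delta> $ i" for i
  proof -
    have "(of_int (\<epsilon> $ i) :: rat) = r * of_int (\<delta> $ i)"
      using arg_cong[OF r, of "\<lambda>v. v $ i"] by (simp add: rat_vec_def)
    then have "(of_int (s * \<epsilon> $ i) :: rat) = of_int (p * \<delta> $ i)" using ps by (simp add: field_simps)
    then show ?thesis by (simp only: of_int_eq_iff)
  qed
  \<comment> \<open>With the factor in lowest terms, its denominator divides every entry of the
    generator, whose entries have gcd 1.\<close>
  have "s dvd \<delta> $ i" for i
    using eq[of i] ps(3) by (metis coprime_commute coprime_dvd_mult_right_iff dvd_triv_left)
  then have "s dvd Gcd (range (\<lambda>i. \<delta> $ i))" by (intro Gcd_greatest) auto
  then have "s = 1" using gen ps(2) by (simp add: primitive_balanced_generator_def)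
  then show ?thesis using eq by auto
qed

text \<open>Otherwise the space would be spanned by 0. The relation obtained is a nonzero multiple
  of the generator, through which the generator inherits the bound on the mass and the vanishing on
  \<open>T\<close>.\<close>

lemma nonzero_relation_exists:
  fixes T :: "real ^ 'm::finite"
  assumes "relation_rank q T = 1"
  shows "\<exists>\<epsilon>. q_relation q \<epsilon> \<and> pairing \<epsilon> T = 0 \<and> \<epsilon> \<noteq> 0"
proof (rule ccontr)
  assume "\<not> ?thesis"
  then have "rat_vec ` {\<delta>. q_relation q \<delta> \<and> pairing \<delta> T = 0} \<subseteq> {0}"
    by (auto simp: rat_vec_def vec_eq_iff)
  then have "relation_space q T \<subseteq> vec.span {0}" unfolding relation_space_def by (rule vec.span_mono)
  then have "vec.dim (relation_space q T) \<le> vec.dim (vec.span {} :: (rat ^ 'm) set)"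
    by (intro vec.dim_subset) simp
  then have "vec.dim (relation_space q T) = 0" unfolding vec.dim_span by simp
  then show False using assms unfolding relation_rank_def by linarith
qed

text \<open>A negative factor exchanges positive and negative parts, which have the same sum in a
  balanced vector.\<close>

lemma mass_multiple_ge:
  assumes "balanced_vec \<delta>" "\<And>i. \<epsilon> $ i = k * \<delta> $ i" "k \<noteq> 0"
  shows "mass \<delta> \<le> mass (\<epsilon> :: int ^ 'm::finite)"
proof -
  have "k \<ge> 1 \<or> k \<le> -1" using assms(3) by linarith
  then show ?thesis
  proof
    assume "k \<ge> 1"
    then have "max x 0 \<le> max (k * x) 0" for x :: int
      using mult_right_mono[of 1 k x] by (cases "x \<ge> 0") auto
    then show ?thesis unfolding mass_def assms(2) by (intro sum_mono)
  next
    assume "k \<le> - 1"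
    then have "max x 0 - x \<le> max (k * x) 0" for x :: int
      using mult_right_mono_neg[of k "- 1" x] by (cases "x \<ge> 0") auto
    then have "(\<Sum>i\<in>UNIV. max (\<delta> $ i) 0 - \<delta> $ i) \<le> mass \<epsilon>"
      unfolding mass_def assms(2) by (intro sum_mono)
    then show ?thesis using assms(1) by (simp add: sum_subtractf mass_def balanced_vec_def)
  qed
qed

theorem proposition6p5:
  fixes q :: nat and T :: "real ^ 5" and \<delta> :: "int ^ 5"
  assumes "q \<ge> 2"
    and "ordered_alphabet T"
    and "relation_rank q T = 1"
    and "primitive_balanced_generator q T \<delta>"
  shows "2 \<le> mass \<delta> \<and> mass \<delta> \<le> int q \<and>
    (\<exists>T' :: int ^ 5. order_preserving_q_model q T T' \<and> primitive_alphabet T' \<and>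
       alphabet_diameter T' \<le> mass \<delta> * int q * (int q + 1))"
proof -
  have bal: "balanced_vec \<delta>" and prim: "Gcd (range (\<lambda>i. \<delta> $ i)) = 1"
    using assms(4) by (simp_all add: primitive_balanced_generator_def)
  obtain \<epsilon> where \<epsilon>: "q_relation q \<epsilon>" "pairing \<epsilon> T = 0" "\<epsilon> \<noteq> 0"
    using nonzero_relation_exists[OF assms(3)] by blast
  obtain k where k: "\<And>i. \<epsilon> $ i = k * \<delta> $ i" using relation_multiple[OF assms(4) \<epsilon>(1,2)] by blast
  have "k \<noteq> 0" using k \<epsilon>(3) by (auto simp: vec_eq_iff)
  have mass_le: "mass \<delta> \<le> int q"
    using mass_multiple_ge[OF bal k \<open>k \<noteq> 0\<close>] \<epsilon>(1) by (simp add: q_relation_def)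
  have pairing_multiple: "pairing \<eta> S = of_int m * pairing \<delta> S" if "\<And>i. \<eta> $ i = m * \<delta> $ i"
    for \<eta> m and S :: "'b::comm_ring_1 ^ 5"
    unfolding pairing_def sum_distrib_left by (simp add: that mult.assoc)
  have \<delta>T: "pairing \<delta> T = 0"
    using pairing_multiple[OF k, of T] \<epsilon>(2) \<open>k \<noteq> 0\<close> by simp

  define c where "c = tail_sum \<delta>"
  have gaps_pos: "gap T x > 0" if "x < 4" for x
    using assms(2) that by (simp add: ordered_alphabet_gap)
  have c_gap: "(\<Sum>x<4. of_int (c x) * gap T x) = 0"
    using \<delta>T by (simp add: pairing_eq_gap_sum[OF bal] c_def)
  have "\<exists>x<4. c x \<noteq> 0"
  proof (rule ccontr)
    assume "\<not> ?thesis"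
    then have "c 0 = 0" "c (Suc 0) = 0" "c 2 = 0" "c 3 = 0" by auto
    then have "\<forall>i. \<delta> $ i = 0" unfolding forall_5 balanced_5[OF bal] c_def by simp
    then have "range (\<lambda>i. \<delta> $ i) = {0}" by auto
    then show False using prim by simp
  qed
  then obtain z where z: "z < 4" "c z \<noteq> 0" by blast
  \<comment> \<open>The gaps of \<open>T\<close> are positive, so tail sums orthogonal to them and
    not all 0 take both signs; \<open>s\<close> is used with the values 1 and -1.\<close>
  have one_sign: False if "\<And>x. x < 4 \<Longrightarrow> of_int s * of_int (c x) \<ge> (0::real)" "s \<noteq> 0" for s :: int
  proof -
    have "(\<Sum>x<4. of_int s * of_int (c x) * gap T x) = of_int s * (\<Sum>x<4. of_int (c x) * gap T x)"
      unfolding sum_distrib_left by (simp add: mult.assoc)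
    then have "(\<Sum>x<4. of_int s * of_int (c x) * gap T x) = 0" using c_gap by simp
    then have "of_int s * of_int (c z) * gap T z = 0"
      using that gaps_pos z(1) by (subst (asm) sum_nonneg_eq_0_iff) (auto simp: less_imp_le)
    then show False using gaps_pos[OF z(1)] z(2) that(2) by simp
  qed
  obtain x where x: "x < 4" "c x > 0"
    using one_sign[of "- 1"] by (force simp: not_less)
  obtain y where y: "y < 4" "c y < 0"
    using one_sign[of 1] by (force simp: not_less)
  have mass_tv: "2 * mass \<delta> = tv c" using mass_eq_tv[OF bal] by (simp add: c_def)
  have "2 \<le> mass \<delta>" using tv_diff[OF x(1) y(1), of c] x(2) y(2) mass_tv by simp

  have "has_generic_gaps (int q) c (mass \<delta> * int q * (int q + 1))"
    using generic_gaps_exist[OF _ mass_tv mass_le x y] assms(1) by simp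
  then obtain g where g: "\<forall>x<4. g x > 0" "Gcd (g ` {..<4}) = 1"
      "(\<Sum>x<4. c x * g x) = 0" "(\<Sum>x<4. g x) \<le> mass \<delta> * int q * (int q + 1)"
    and gen: "\<forall>C. tv C \<le> 2 * int q \<longrightarrow> (\<Sum>x<4. C x * g x) = 0 \<longrightarrow> (\<forall>x<4. \<forall>y<4. C x * c y = C y * c x)"
    by (elim has_generic_gaps_primitive[THEN exE] conjE) (rule that)
  \<comment> \<open>The letters are the partial sums of the gaps, starting at 0.\<close>
  define T' :: "int ^ 5" where
    "T' = (\<chi> i. if i = 0 then 0 else if i = 1 then g 0 else if i = 2 then g 0 + g 1
      else if i = 3 then g 0 + g 1 + g 2 else g 0 + g 1 + g 2 + g 3)"
  have T': "T' $ 0 = 0" "T' $ 1 = g 0" "T' $ 2 = g 0 + g 1" "T' $ 3 = g 0 + g 1 + g 2"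
      "T' $ 4 = g 0 + g 1 + g 2 + g 3"
    by (simp_all add: T'_def)
  have gap_T': "gap T' x = g x" if "x < 4" for x
    using that unfolding lt4_cases by (auto simp: T')
  have pairing_T': "pairing \<eta> T' = (\<Sum>x<4. tail_sum \<eta> x * g x)" if "balanced_vec \<eta>" for \<eta>
    unfolding pairing_eq_gap_sum[OF that] by (rule sum.cong) (simp_all add: gap_T')

  have "order_preserving_q_model q T T'"
    unfolding order_preserving_q_model_def
  proof (intro conjI allI impI)
    show "ordered_alphabet T'" unfolding ordered_alphabet_gap using g(1) gap_T' by simp
    fix \<eta> :: "int ^ 5"
    assume \<eta>: "q_relation q \<eta>"
    then have bal\<eta>: "balanced_vec \<eta>" and mass\<eta>: "mass \<eta> \<le> int q" by (auto simp: q_relation_def)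
    show "pairing \<eta> T = 0 \<longleftrightarrow> pairing \<eta> T' = 0"
    proof
      assume "pairing \<eta> T = 0"
      then obtain m where m: "\<And>i. \<eta> $ i = m * \<delta> $ i" using relation_multiple[OF assms(4) \<eta>] by blast
      have "pairing \<delta> T' = 0" using pairing_T'[OF bal] g(3) by (simp add: c_def)
      then show "pairing \<eta> T' = 0" using pairing_multiple[OF m, of T'] by simp
    next
      assume "pairing \<eta> T' = 0"
      then have "(\<Sum>x<4. tail_sum \<eta> x * g x) = 0" using pairing_T'[OF bal\<eta>] by simp
      moreover have "tv (tail_sum \<eta>) \<le> 2 * int q" using mass_eq_tv[OF bal\<eta>] mass\<eta> by simp
      ultimately have propn: "tail_sum \<eta> x * c z = tail_sum \<eta> z * c x" if "x < 4" for x
        using gen that z(1) by blast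
      \<comment> \<open>The factor \<open>c z\<close> clears the denominator in the proportionality
        of \<open>tail_sum \<eta>\<close> to \<open>c\<close>.\<close>
      have "of_int (c z) * pairing \<eta> T = (\<Sum>x<4. of_int (tail_sum \<eta> x * c z) * gap T x)"
        unfolding pairing_eq_gap_sum[OF bal\<eta>] sum_distrib_left by (simp add: algebra_simps)
      also have "\<dots> = (\<Sum>x<4. of_int (tail_sum \<eta> z) * (of_int (c x) * gap T x))"
        by (rule sum.cong) (simp_all add: propn)
      also have "\<dots> = 0" using c_gap unfolding sum_distrib_left[symmetric] by simp
      finally show "pairing \<eta> T = 0" using z(2) by simp
    qed
  qed
  moreover have "primitive_alphabet T'"
    unfolding primitive_alphabet_def Min_5
  proof -
    let ?G = "Gcd (range (\<lambda>i. T' $ i - T' $ 0))"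
    have dvd: "?G dvd T' $ i" for i
    proof -
      have "?G dvd T' $ i - T' $ 0" by (rule Gcd_dvd) simp
      then show ?thesis by (simp add: T')
    qed
    \<comment> \<open>Gaps are differences of letters, so a common divisor of the letters divides
      all gaps.\<close>
    have "?G dvd g x" if "x < 4" for x
    proof -
      have "?G dvd gap T' x"
        using that dvd unfolding lt4_cases by (elim disjE) (simp_all add: dvd_diff)
      then show ?thesis using gap_T' that by simp
    qed
    then have "?G dvd Gcd (g ` {..<4})" by (intro Gcd_greatest) auto
    then have "?G dvd 1" using g(2) by simp
    moreover have "?G \<ge> 0" by simp
    ultimately show "?G = 1" by simp
  qed
  moreover have "alphabet_diameter T' \<le> mass \<delta> * int q * (int q + 1)"
    using g(4) unfolding alphabet_diameter_def Min_5 Max_5 by (simp add: T' sum_4)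
  ultimately show ?thesis using \<open>2 \<le> mass \<delta>\<close> mass_le by blast
qed

end
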